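(* Let $(T_i)_{i\ge 1}$ be the i.i.d. inter-arrival times of a renewal process, supported on $(0,\infty)$, with $\mathbb{E}(T_i)=t$. For $s\ge 0$ let $N(s)$ be the number of events of the process from its start up to time $s$, and let $\mu(s)=\mathbb{E}(N(s))$. Let $u>0$. If the renewal process is non-arithmetic, then $$\lim_{m\to\infty}\bigl(\mu(m+u)-\mu(m)\bigr)=\frac{u}{t}.$$ If the renewal process is arithmetic with span $\lambda$, then the same limit relation holds whenever $u$ is a multiple of $\lambda$.
   Context: A renewal process is a point process on the half-line starting at time $0$ whose inter-arrival times $T_1,T_2,\dots$ are i.i.d. positive random variables (here with finite mean $t$). The $i$-th event happens at time $S_i=\sum_{k=1}^i T_k$, and $N(s)=\#\{i\ge 1: S_i\le s\}$. The process is called arithmetic if there is a scalar $\lambda>0$ such that events can happen only at integer multiples of $\lambda$ (almost surely); the largest such $\lambda$ is called the span. Otherwise it is called non-arithmetic. *)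

theory Defs
  imports "HOL-Probability.Probability"
begin

text \<open>
  The inter-arrival times are \<open>T 1, T 2, \<dots>\<close>; the value \<open>T 0\<close> plays no role.
  Measurability of each \<open>T i\<close> is part of \<open>indep_vars\<close>.
\<close>

locale renewal_process = prob_space M
  for M :: "'a measure" and T :: "nat \<Rightarrow> 'a \<Rightarrow> real" +
  assumes indep: "indep_vars (\<lambda>_. borel) T {1..}"
    and ident_distr: "\<And>i. i \<ge> 1 \<Longrightarrow> distr M borel (T i) = distr M borel (T 1)"
    and positive: "\<And>i. i \<ge> 1 \<Longrightarrow> AE \<omega> in M. T i \<omega> > 0"

definition event_time :: "(nat \<Rightarrow> 'a \<Rightarrow> real) \<Rightarrow> nat \<Rightarrow> 'a \<Rightarrow> real" where
  "event_time T i \<omega> = (\<Sum>k=1..i. T k \<omega>)"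

text \<open>
  For a renewal process the set counted here is almost surely finite, so the convention
  that \<open>card\<close> is 0 on infinite sets only affects a null set.
\<close>

definition event_count :: "(nat \<Rightarrow> 'a \<Rightarrow> real) \<Rightarrow> real \<Rightarrow> 'a \<Rightarrow> nat" where
  "event_count T s \<omega> = card {i. i \<ge> 1 \<and> event_time T i \<omega> \<le> s}"

text \<open>
  For a renewal process \<open>event_count T s\<close> is integrable for every \<open>s\<close>, so this Bochner
  integral is the true expectation.
\<close>

definition renewal_function :: "'a measure \<Rightarrow> (nat \<Rightarrow> 'a \<Rightarrow> real) \<Rightarrow> real \<Rightarrow> real" where
  "renewal_function M T s = (\<integral>\<omega>. real (event_count T s \<omega>) \<partial>M)"

definition events_on_multiples :: "'a measure \<Rightarrow> (nat \<Rightarrow> 'a \<Rightarrow> real) \<Rightarrow> real \<Rightarrow> bool" where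
  "events_on_multiples M T d \<longleftrightarrow>
     (AE \<omega> in M. \<forall>i\<ge>1. \<exists>k::int. event_time T i \<omega> = of_int k * d)"

definition arithmetic :: "'a measure \<Rightarrow> (nat \<Rightarrow> 'a \<Rightarrow> real) \<Rightarrow> bool" where
  "arithmetic M T \<longleftrightarrow> (\<exists>d>0. events_on_multiples M T d)"

definition has_span :: "'a measure \<Rightarrow> (nat \<Rightarrow> 'a \<Rightarrow> real) \<Rightarrow> real \<Rightarrow> bool" where
  "has_span M T d \<longleftrightarrow>
     d > 0 \<and> events_on_multiples M T d \<and>
     (\<forall>d'>0. events_on_multiples M T d' \<longrightarrow> d' \<le> d)"

end

theory Submission
  imports Defs "HOL-Real_Asymp.Real_Asymp"
begin

text \<open>
  Let \<open>U\<close> be the measure counting the expected number of events, and smooth it to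
  \<open>Z(x) = \<integral> \<Lambda>(x - s) U(ds)\<close> with a triangular kernel \<open>\<Lambda>\<close> of half-width \<open>w\<close>. The function
  \<open>Z\<close> is bounded, Lipschitz, and satisfies \<open>Z(x) = E Z(x - T)\<close> for large \<open>x\<close>. If \<open>a\<close> lies
  in the support of \<open>T\<close>, then \<open>d(x) = Z(x + a) - Z(x)\<close> tends to 0: by the averaging property,
  wherever \<open>d\<close> comes close to its upper limit \<open>\<eta>\<close>, it does so along a long progression of
  step \<open>-a\<close> as well; the increments telescope, so a nonzero \<open>\<eta>\<close> would contradict boundedness.
  The set of all \<open>a\<close> with \<open>Z(x + a) - Z(x) \<longlongrightarrow> 0\<close> is a closed subgroup that carries \<open>T\<close>, so it is
  all of \<open>\<real>\<close> in the non-arithmetic case and contains the span otherwise.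

  The value of the limit comes from the identity \<open>\<integral> P(T > x - s) 1{s \<le> x} U(ds) = 1\<close> (exactly one
  event is the last one up to time \<open>x\<close>): sandwiching \<open>P(T > y)\<close> and the indicator of
  \<open>[0, u)\<close> between combinations of kernels translated by multiples of \<open>w\<close> eliminates \<open>Z\<close> and
  leaves \<open>U(x - u, x] \<longlongrightarrow> u / t\<close> as \<open>w \<longlongrightarrow> 0\<close>; in the arithmetic case, \<open>w\<close> is the span
  and the combinations are exact on the lattice.
\<close>

section \<open>Averaging and closed subgroups of the reals\<close>

text \<open>The increment \<open>d\<close> is, far out, an average of its own translates. If its
  limit superior \<eta> were positive, a value near \<eta> at \<open>t\<close> would force a value
  near \<eta> at \<open>t - a\<close>, because every ball around \<open>a\<close> has positive mass.
  Iterating this and telescoping contradicts the bound \<open>B\<close>.\<close>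

lemma (in real_distribution) harmonic_increment_upper:
  fixes Z :: "real \<Rightarrow> real"
  assumes bound: "\<And>x. \<bar>Z x\<bar> \<le> B"
    and lip: "L-lipschitz_on UNIV Z"
    and harm: "\<And>x. x \<ge> X0 \<Longrightarrow> Z x = (\<integral>y. Z (x - y) \<partial>M)"
    and supp: "\<And>r. r > 0 \<Longrightarrow> prob (ball a r) > 0"
    and "e > 0"
  shows "eventually (\<lambda>x. Z (x + a) - Z x \<le> e) at_top"
proof (rule ccontr)
  assume *: "\<not> ?thesis"
  define d where "d x = Z (x + a) - Z x" for x
  have contZ: "continuous_on UNIV Z" using lip by (rule lipschitz_on_continuous_on)
  have measZ [measurable]: "Z \<in> borel_measurable borel"
    using contZ by (rule borel_measurable_continuous_onI)
  have measd [measurable]: "d \<in> borel_measurable borel" unfolding d_def by measurable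
  have dB: "d x \<le> 2 * B" for x using bound[of x] bound[of "x+a"] unfolding d_def by linarith
  have dB': "\<bar>d x\<bar> \<le> 2 * B" for x using bound[of x] bound[of "x+a"] unfolding d_def by linarith
  have L0: "L \<ge> 0" using lip by (rule lipschitz_on_nonneg)
  have dlip: "\<bar>d x - d y\<bar> \<le> 2 * L * \<bar>x - y\<bar>" for x y
  proof -
    have "\<bar>Z x - Z y\<bar> \<le> L * \<bar>x - y\<bar>" for x y
      using lipschitz_onD[OF lip, of x y] by (simp add: dist_real_def)
    from this[of x y] this[of "x+a" "y+a"] show ?thesis unfolding d_def by (simp add: algebra_simps)
  qed
  have intZ: "integrable M (\<lambda>y. Z (x - y))" for x
    by (rule integrable_const_bound[of _ B]) (auto simp: bound)
  have intd: "integrable M (\<lambda>y. d (x - y))" for x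
    by (rule integrable_const_bound[of _ "2*B"]) (auto simp: dB')
  \<comment> \<open>Beyond \<open>X1\<close> the averaging identity for \<open>Z\<close> is
    available at both \<open>x\<close> and \<open>x + a\<close>.\<close>
  define X1 where "X1 = max X0 (X0 - a)"
  have dharm: "d x = (\<integral>y. d (x - y) \<partial>M)" if "x \<ge> X1" for x
  proof -
    have "(\<integral>y. d (x - y) \<partial>M) = (\<integral>y. Z ((x + a) - y) - Z (x - y) \<partial>M)"
      unfolding d_def by (simp add: algebra_simps)
    also have "\<dots> = Z (x + a) - Z x"
      using that harm[of x] harm[of "x+a"] intZ by (subst Bochner_Integration.integral_diff) (auto simp: X1_def)
    finally show ?thesis by (simp add: d_def)
  qed
  \<comment> \<open>Levels that \<open>d\<close> exceeds at arbitrarily large arguments; their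
    supremum \<eta> is the limit superior of \<open>d\<close>.\<close>
  define V where "V = {v. frequently (\<lambda>x. d x > v) at_top}"
  have "e \<in> V" using * unfolding V_def d_def frequently_def by (simp add: not_less)
  have Vbd: "v \<le> 2 * B" if "v \<in> V" for v
  proof (rule ccontr)
    assume "\<not> v \<le> 2 * B"
    hence "\<not> v < d x" for x using dB[of x] by linarith
    thus False using that by (simp add: V_def)
  qed
  have bdd: "bdd_above V" by (rule bdd_aboveI[OF Vbd])
  define \<eta> where "\<eta> = Sup V"
  have \<eta>e: "\<eta> \<ge> e" unfolding \<eta>_def using \<open>e \<in> V\<close> bdd by (rule cSup_upper)
  have \<eta>B: "\<eta> \<le> 2 * B" unfolding \<eta>_def using \<open>e \<in> V\<close> Vbd by (intro cSup_least) auto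
  have fr: "frequently (\<lambda>x. d x > \<eta> - \<delta>) at_top" if "\<delta> > 0" for \<delta>
  proof -
    from that have "\<eta> - \<delta> < Sup V" by (simp add: \<eta>_def)
    then obtain v where "v \<in> V" "\<eta> - \<delta> < v"
      using less_cSup_iff[OF _ bdd] \<open>e \<in> V\<close> by auto
    thus ?thesis unfolding V_def by (auto elim!: frequently_elim1)
  qed
  have ev: "eventually (\<lambda>x. d x \<le> \<eta> + \<delta>) at_top" if "\<delta> > 0" for \<delta>
  proof (rule ccontr)
    assume "\<not> ?thesis"
    hence "\<eta> + \<delta> \<in> V" unfolding V_def frequently_def by (simp add: not_less)
    hence "\<eta> + \<delta> \<le> \<eta>" unfolding \<eta>_def using bdd by (intro cSup_upper) 
    thus False using that by simp
  qed
  have step: "\<exists>\<delta>>0. \<exists>X. \<forall>t\<ge>X. d t \<ge> \<eta> - \<delta> \<longrightarrow> d (t - a) \<ge> \<eta> - \<epsilon>" if "\<epsilon> > 0" for \<epsilon>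
  proof -
    \<comment> \<open>On \<open>ball a r\<close> the \<open>2 * L\<close>-Lipschitz function
      \<open>d\<close> deviates from its value at the centre by at most \<epsilon>/4; the
      \<open>+ 1\<close> covers \<open>L = 0\<close>.\<close>
    define r where "r = \<epsilon> / (4 * (2 * L + 1))"
    have r: "r > 0" "2 * L * r \<le> \<epsilon> / 4" using that L0 by (auto simp: r_def field_simps)
    define p where "p = prob (ball a r)"
    have p: "p > 0" using supp r by (simp add: p_def)
    \<comment> \<open>The estimate below loses \<open>3 * \<delta>\<close> in total; spread over the
      mass \<open>p\<close> of the ball this is \<open>3 * \<epsilon> / 4\<close>.\<close>
    define \<delta> where "\<delta> = p * \<epsilon> / 4"
    have \<delta>: "\<delta> > 0" using p that by (simp add: \<delta>_def)
    from ev[OF \<delta>] obtain X2 where X2: "\<And>x. x \<ge> X2 \<Longrightarrow> d x \<le> \<eta> + \<delta>"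
      by (auto simp: eventually_at_top_linorder)
    define C where "C = 2 * B - \<eta>"
    have C: "C \<ge> 0" using \<eta>B by (simp add: C_def)
    have "((\<lambda>x. C * (1 - cdf M x)) \<longlongrightarrow> C * (1 - 1)) at_top"
      by (intro tendsto_intros cdf_lim_at_top_prob)
    hence "eventually (\<lambda>x. C * (1 - cdf M x) < \<delta>) at_top"
      using \<delta> by (intro order_tendstoD) auto
    then obtain X3 where X3: "\<And>x. x \<ge> X3 \<Longrightarrow> C * (1 - cdf M x) < \<delta>"
      by (auto simp: eventually_at_top_linorder)
    have "d (t - a) \<ge> \<eta> - \<epsilon>" if t: "t \<ge> max X1 (X2 + X3)" and dt: "d t \<ge> \<eta> - \<delta>" for t
    proof -
      define q where "q = d (t - a) + \<epsilon> / 4 - \<eta> - \<delta>"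
      \<comment> \<open>A majorant of \<open>d (t - y)\<close>: the generic bound
        \<open>\<eta> + \<delta>\<close>, corrected by \<open>q\<close> to the local bound near
        \<open>a\<close>, and raised by \<open>C\<close> to the crude bound where
        \<open>t - y\<close> falls below \<open>X2\<close>. That last region has small mass for
        large \<open>t\<close>.\<close>
      let ?R = "\<lambda>y. (\<eta> + \<delta>) + (q * indicator (ball a r) y + C * indicator {t - X2<..} y)"
      have le: "d (t - y) \<le> ?R y" for y
      proof (cases "y \<in> ball a r")
        case True
        have "d (t - y) \<le> d (t - a) + 2 * L * \<bar>a - y\<bar>" using dlip[of "t - y" "t - a"] by (simp add: abs_minus_commute)
        also have "2 * L * \<bar>a - y\<bar> \<le> 2 * L * r" using True L0 by (intro mult_left_mono) (auto simp: dist_real_def)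
        finally have "d (t - y) \<le> d (t - a) + \<epsilon> / 4" using r by linarith
        thus ?thesis using True C by (auto simp: q_def indicator_def)
      next
        case False
        show ?thesis
        proof (cases "y > t - X2")
          case True
          thus ?thesis using False dB[of "t - y"] \<delta> by (simp add: C_def)
        next
          case F2: False
          thus ?thesis using False X2[of "t - y"] by simp
        qed
      qed
      have int_ind: "integrable M (\<lambda>y. k * indicator (S :: real set) y :: real)" if "S \<in> sets borel" for S k
        using that by (auto intro!: integrable_real_indicator simp: emeasure_eq_measure)
      have "\<eta> - \<delta> \<le> (\<integral>y. d (t - y) \<partial>M)" using dt t dharm[of t] by simp
      also have "\<dots> \<le> (\<integral>y. ?R y \<partial>M)" 
        using le by (intro integral_mono intd) (auto intro!: int_ind Bochner_Integration.integrable_add)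
      also have "\<dots> = (\<eta> + \<delta>) + (q * p + C * prob {t - X2<..})"
      proof -
        have 1: "(\<integral>y. q * indicator (ball a r) y + C * indicator {t - X2<..} y \<partial>M) = q * p + C * prob {t - X2<..}"
          by (subst Bochner_Integration.integral_add[OF int_ind int_ind]) (auto simp: p_def)
        show ?thesis
          by (subst Bochner_Integration.integral_add[OF _ Bochner_Integration.integrable_add[OF int_ind int_ind]])
            (auto simp: 1 prob_space[unfolded space_eq_univ])
      qed
      also have "prob {t - X2<..} = 1 - cdf M (t - X2)"
      proof -
        have "{t - X2<..} = UNIV - {..t - X2}" by auto
        thus ?thesis unfolding cdf_def using prob_compl[of "{..t - X2}"] by simp
      qed
      also have "C * \<dots> \<le> \<delta>" using X3[of "t - X2"] t by simp
      finally have "q * p \<ge> - (3 * \<delta>)" by linarith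
      hence "p * (q + 3 * \<epsilon> / 4) \<ge> 0" by (simp add: \<delta>_def algebra_simps)
      hence "q + 3 * \<epsilon> / 4 \<ge> 0" using p by (simp add: zero_le_mult_iff)
      thus ?thesis using \<delta> unfolding q_def by linarith
    qed
    thus ?thesis using \<delta> by blast
  qed
  have iter: "\<exists>\<delta>>0. \<exists>X. \<forall>t\<ge>X. d t \<ge> \<eta> - \<delta> \<longrightarrow> (\<forall>j\<le>k. d (t - real j * a) \<ge> \<eta> - \<epsilon>)"
    if "\<epsilon> > 0" for \<epsilon> and k :: nat
    using that
  proof (induction k arbitrary: \<epsilon>)
    case 0
    thus ?case by (intro exI[of _ \<epsilon>]) auto
  next
    case (Suc k)
    from step[OF Suc.prems] obtain \<delta>1 Y1 where 1: "\<delta>1 > 0"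
      "\<And>t. t \<ge> Y1 \<Longrightarrow> d t \<ge> \<eta> - \<delta>1 \<Longrightarrow> d (t - a) \<ge> \<eta> - \<epsilon>" by blast
    \<comment> \<open>The minimum serves two purposes: \<epsilon> is the accuracy claimed for
      \<open>j \<le> k\<close>, and \<open>\<delta>1\<close> is the accuracy at step
      \<open>k\<close> that makes one more step possible.\<close>
    from Suc.IH[of "min \<epsilon> \<delta>1"] 1(1) Suc.prems obtain \<delta>2 Y2 where 2: "\<delta>2 > 0"
      "\<And>t j. t \<ge> Y2 \<Longrightarrow> d t \<ge> \<eta> - \<delta>2 \<Longrightarrow> j \<le> k \<Longrightarrow> d (t - real j * a) \<ge> \<eta> - min \<epsilon> \<delta>1" by auto
    have "d (t - real j * a) \<ge> \<eta> - \<epsilon>"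
      if t: "t \<ge> max Y2 (Y1 + real k * a)" "d t \<ge> \<eta> - \<delta>2" "j \<le> Suc k" for t j
    proof (cases "j \<le> k")
      case True
      thus ?thesis using 2(2)[of t j] t by auto
    next
      case False
      hence j: "j = Suc k" using t by auto
      have "d (t - real k * a) \<ge> \<eta> - \<delta>1" using 2(2)[of t k] t by auto
      from 1(2)[OF _ this] t show ?thesis by (simp add: j algebra_simps)
    qed
    thus ?case using 2(1) by blast
  qed
  have \<eta>: "\<eta> > 0" using \<eta>e \<open>e > 0\<close> by simp
  \<comment> \<open>With this many steps, increments of at least \<eta>/2 add up to more than the
    oscillation \<open>2 * B\<close> of \<open>Z\<close>.\<close>
  obtain k :: nat where k: "real k * (\<eta> / 2) > 2 * B"
    using reals_Archimedean3[OF half_gt_zero[OF \<eta>]] by blast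
  from iter[of "\<eta> / 2" k] \<eta> obtain \<delta> X where dX: "\<delta> > 0"
    "\<And>t j. t \<ge> X \<Longrightarrow> d t \<ge> \<eta> - \<delta> \<Longrightarrow> j \<le> k \<Longrightarrow> d (t - real j * a) \<ge> \<eta> - \<eta> / 2" by auto
  obtain t where t: "t \<ge> X" "d t > \<eta> - \<delta>"
    using frequently_eventually_frequently[OF fr[OF dX(1)] eventually_ge_at_top[of X]]
    by (auto dest: frequently_ex)
  have "real k * (\<eta> / 2) = (\<Sum>j<k. \<eta> / 2)" by simp
  also have "\<dots> \<le> (\<Sum>j<k. d (t - real j * a))" using dX(2)[of t] t by (intro sum_mono) (auto simp: field_simps)
  also have "\<dots> = Z (t + a) - Z (t + a - real k * a)"
    by (induction k) (auto simp: d_def algebra_simps)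
  also have "\<dots> \<le> 2 * B" using bound[of "t+a"] bound[of "t + a - real k * a"] by linarith
  finally show False using k by simp
qed

text \<open>The hypotheses are invariant under \<open>Z \<mapsto> - Z\<close>, so the one-sided
  estimate applies to both signs.\<close>

lemma (in real_distribution) harmonic_increment_tendsto_0:
  fixes Z :: "real \<Rightarrow> real"
  assumes bound: "\<And>x. \<bar>Z x\<bar> \<le> B"
    and lip: "L-lipschitz_on UNIV Z"
    and harm: "\<And>x. x \<ge> X0 \<Longrightarrow> Z x = (\<integral>y. Z (x - y) \<partial>M)"
    and supp: "\<And>r. r > 0 \<Longrightarrow> prob (ball a r) > 0"
  shows "((\<lambda>x. Z (x + a) - Z x) \<longlongrightarrow> 0) at_top"
proof (rule tendstoI)
  fix e :: real assume e: "e > 0"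
  have "eventually (\<lambda>x. Z (x + a) - Z x \<le> e / 2) at_top"
    using e by (intro harmonic_increment_upper[OF bound lip harm supp]) auto
  moreover have "eventually (\<lambda>x. (- Z (x + a)) - (- Z x) \<le> e / 2) at_top"
    using e by (intro harmonic_increment_upper[of "\<lambda>x. - Z x" B L X0, OF _ _ _ supp])
      (auto simp: bound harm lip)
  ultimately show "eventually (\<lambda>x. dist (Z (x + a) - Z x) 0 < e) at_top"
    by eventually_elim (use e in \<open>auto simp: dist_real_def abs_if\<close>)
qed

text \<open>Let \<open>c\<close> be the infimum of the positive elements. If \<open>c = 0\<close>,
  the subgroup is dense, hence everything by closedness. If \<open>c > 0\<close>, then
  \<open>c\<close> is attained by closedness, and division with remainder by \<open>c\<close> leaves
  a remainder in the subgroup below \<open>c\<close>, which must be 0.\<close>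

lemma closed_additive_subgroup_real:
  fixes H :: "real set"
  assumes "closed H" and zero: "0 \<in> H" and diff: "\<And>x y. x \<in> H \<Longrightarrow> y \<in> H \<Longrightarrow> x - y \<in> H"
    and pos: "b \<in> H" "b > 0"
  shows "H = UNIV \<or> (\<exists>c>0. H = range (\<lambda>k::int. of_int k * c))"
proof -
  have neg: "- x \<in> H" if "x \<in> H" for x using diff[OF zero that] by simp
  have add: "x + y \<in> H" if "x \<in> H" "y \<in> H" for x y using diff[OF that(1) neg[OF that(2)]] by simp
  have natmult: "real n * x \<in> H" if "x \<in> H" for n x
    by (induction n) (auto simp: zero algebra_simps intro: add that)
  have mult: "of_int k * x \<in> H" if "x \<in> H" for k :: int and x
  proof (cases "k \<ge> 0")
    case True thus ?thesis using natmult[OF that, of "nat k"] by simp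
  next
    case False thus ?thesis using neg[OF natmult[OF that, of "nat (-k)"]] by simp
  qed
  define P where "P = {x \<in> H. x > 0}"
  define c where "c = Inf P"
  have P: "b \<in> P" "bdd_below P" using pos by (auto simp: P_def intro!: bdd_belowI[of _ 0])
  have c_le: "c \<le> x" if "x \<in> P" for x unfolding c_def using that P by (intro cInf_lower)
  have c0: "c \<ge> 0" unfolding c_def using P by (intro cInf_greatest) (auto simp: P_def)
  have close: "\<exists>h\<in>P. h < c + e" if "e > 0" for e
    using cInf_less_iff[of P "c + e"] P that by (auto simp: c_def)
  have approx: "\<exists>h\<in>H. \<bar>x - h\<bar> < h0" if "h0 \<in> P" for x h0
  proof (intro bexI)
    show "of_int \<lfloor>x / h0\<rfloor> * h0 \<in> H" using that by (intro mult) (auto simp: P_def)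
    have "x - of_int \<lfloor>x / h0\<rfloor> * h0 = frac (x / h0) * h0" using that by (simp add: frac_def P_def field_simps)
    moreover have "frac (x / h0) * h0 < 1 * h0" using that frac_lt_1[of "x/h0"] by (intro mult_strict_right_mono) (auto simp: P_def)
    moreover have "frac (x / h0) * h0 \<ge> 0" using that by (simp add: P_def)
    ultimately show "\<bar>x - of_int \<lfloor>x / h0\<rfloor> * h0\<bar> < h0" by simp
  qed
  show ?thesis
  proof (cases "c = 0")
    case True
    have "x \<in> closure H" for x
    proof (unfold closure_approachable, intro allI impI)
      fix e :: real assume "e > 0"
      from close[OF this] True obtain h where "h \<in> P" "h < e" by auto
      with approx[of h x] show "\<exists>y\<in>H. dist y x < e" by (force simp: dist_real_def abs_minus_commute)
    qed
    thus ?thesis using \<open>closed H\<close> by auto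
  next
    case False
    hence c: "c > 0" using c0 by simp
    have "c \<in> closure H" 
    proof (unfold closure_approachable, intro allI impI)
      fix e :: real assume "e > 0"
      from close[OF this] obtain h where "h \<in> P" "h < c + e" by auto
      with c_le[of h] show "\<exists>y\<in>H. dist y c < e" by (intro bexI[of _ h]) (auto simp: dist_real_def P_def)
    qed
    hence cH: "c \<in> H" using \<open>closed H\<close> by simp
    have "x \<in> range (\<lambda>k::int. of_int k * c)" if "x \<in> H" for x
    proof -
      define y where "y = x - of_int \<lfloor>x / c\<rfloor> * c"
      have yH: "y \<in> H" unfolding y_def using that cH by (intro diff mult)
      have y: "y = frac (x / c) * c" using c by (simp add: y_def frac_def field_simps)
      have "frac (x / c) * c < 1 * c" using c frac_lt_1[of "x/c"] by (intro mult_strict_right_mono)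
      hence "y < c" by (simp add: y)
      hence "y \<notin> P" using c_le[of y] by auto
      moreover have "y \<ge> 0" using c by (simp add: y)
      ultimately have "y = 0" using yH by (auto simp: P_def)
      thus ?thesis by (auto simp: y_def)
    qed
    hence "H = range (\<lambda>k::int. of_int k * c)" using mult[OF cH] by auto
    thus ?thesis using c by blast
  qed
qed

text \<open>Closedness comes from the Lipschitz bound: replacing \<open>a\<close> by a nearby
  \<open>b\<close> changes the increment by a small amount, uniformly in \<open>x\<close>.\<close>

lemma lipschitz_increment_closed_subgroup:
  fixes Z :: "real \<Rightarrow> real"
  assumes lip: "L-lipschitz_on UNIV Z"
  defines "A \<equiv> {a. ((\<lambda>x. Z (x + a) - Z x) \<longlongrightarrow> 0) at_top}"
  shows "closed A" "0 \<in> A" "\<And>a b. a \<in> A \<Longrightarrow> b \<in> A \<Longrightarrow> a - b \<in> A"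
proof -
  show "0 \<in> A" by (simp add: A_def)
  show "a - b \<in> A" if "a \<in> A" "b \<in> A" for a b
  proof -
    have lim: "filterlim (\<lambda>x::real. x - b) at_top at_top"
      using filterlim_tendsto_add_at_top[OF tendsto_const filterlim_ident, of "-b"] by simp
    \<comment> \<open>Both null increments are taken from the base point \<open>x - b\<close>; their
      difference is \<open>Z (x + (a - b)) - Z x\<close>.\<close>
    have "((\<lambda>x. (Z ((x - b) + a) - Z (x - b)) - (Z ((x - b) + b) - Z (x - b))) \<longlongrightarrow> 0 - 0) at_top"
      using that by (intro tendsto_diff filterlim_compose[OF _ lim]) (auto simp: A_def)
    thus ?thesis by (simp add: A_def algebra_simps)
  qed
  have "closure A \<subseteq> A"
  proof
    fix a assume a: "a \<in> closure A"
    have L0: "L \<ge> 0" using lip by (rule lipschitz_on_nonneg)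
    show "a \<in> A" unfolding A_def
    proof (intro CollectI tendstoI)
      fix e :: real assume e: "e > 0"
      define r where "r = e / (2 * (L + 1))"
      have r: "r > 0" "L * r \<le> e / 2" using e L0 by (auto simp: r_def field_simps)
      obtain b where b: "b \<in> A" "dist b a < r" using a r(1) by (auto simp: closure_approachable)
      have bd: "\<bar>Z (x + a) - Z (x + b)\<bar> \<le> e / 2" for x
      proof -
        have "\<bar>Z (x + a) - Z (x + b)\<bar> \<le> L * \<bar>a - b\<bar>"
          using lipschitz_onD[OF lip, of "x+a" "x+b"] by (simp add: dist_real_def)
        also have "\<dots> \<le> L * r" using b L0 by (intro mult_left_mono) (auto simp: dist_real_def)
        finally show ?thesis using r by linarith
      qed
      have "((\<lambda>x. Z (x + b) - Z x) \<longlongrightarrow> 0) at_top" using b by (simp add: A_def)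
      hence "eventually (\<lambda>x. dist (Z (x + b) - Z x) 0 < e / 2) at_top" using e by (intro tendstoD) auto
      thus "eventually (\<lambda>x. dist (Z (x + a) - Z x) 0 < e) at_top"
      proof eventually_elim
        case (elim x)
        thus ?case using bd[of x] unfolding dist_real_def by linarith
      qed
    qed
  qed
  thus "closed A" by (simp add: closure_subset_eq)
qed

text \<open>By the Lindelof property, countably many of the null open sets already cover the
  complement of \<open>A\<close>. The hypothesis says that \<open>A\<close> contains the support of
  the law.\<close>

lemma (in real_distribution) AE_mem_closed:
  assumes "closed A" and null: "\<And>a. a \<notin> A \<Longrightarrow> \<exists>r>0. prob (ball a r) = 0"
  shows "AE y in M. y \<in> A"
proof -
  define F where "F = {B. open B \<and> prob B = 0}"
  obtain F' where F': "F' \<subseteq> F" "countable F'" "\<Union>F' = \<Union>F"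
    using Lindelof[of F] by (auto simp: F_def)
  have null_cover: "AE y in M. \<forall>B\<in>F'. y \<notin> B"
  proof (subst AE_ball_countable[OF F'(2)], intro ballI)
    fix B assume "B \<in> F'"
    hence "open B" "prob B = 0" using F' by (auto simp: F_def)
    hence "B \<in> null_sets M" by (auto simp: null_sets_def emeasure_eq_measure)
    thus "AE y in M. y \<notin> B" by (rule AE_not_in)
  qed
  have cover: "y \<in> \<Union>F'" if y: "y \<notin> A" for y
  proof -
    obtain r where "r > 0" "prob (ball y r) = 0" using null[OF y] by auto
    hence "y \<in> ball y r" "ball y r \<in> F" by (auto simp: F_def)
    thus ?thesis unfolding F'(3) by blast
  qed
  show ?thesis using null_cover by eventually_elim (use cover in blast)
qed

section \<open>The renewal measure\<close>

context renewal_process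
begin

lemma measurable_T: "i \<ge> 1 \<Longrightarrow> T i \<in> borel_measurable M"
  using indep by (auto simp: indep_vars_def)

lemma measurable_event_time [measurable]: "event_time T n \<in> borel_measurable M"
  unfolding event_time_def[abs_def] by (intro borel_measurable_sum measurable_T) auto

lemma event_time_0 [simp]: "event_time T 0 \<omega> = 0"
  by (simp add: event_time_def)

definition interarrival :: "real measure" where
  "interarrival = distr M borel (T 1)"

sublocale interarrival: real_distribution interarrival
  unfolding interarrival_def by (intro real_distribution_distr measurable_T) auto

lemma AE_interarrival_iff:
  assumes "Measurable.pred borel P" "i \<ge> 1"
  shows "(AE y in interarrival. P y) \<longleftrightarrow> (AE \<omega> in M. P (T i \<omega>))"
proof -
  have *: "interarrival = distr M borel (T i)" using ident_distr[OF assms(2)] by (simp add: interarrival_def)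
  show ?thesis unfolding *
    by (rule AE_distr_iff) (use assms measurable_T[OF assms(2)] in \<open>auto simp: pred_def\<close>)
qed

lemma AE_interarrival_pos: "AE y in interarrival. y > 0"
  by (subst AE_interarrival_iff[of _ 1]) (use positive in auto)

lemma AE_event_time_nonneg: "AE \<omega> in M. event_time T n \<omega> \<ge> 0"
proof -
  have "AE \<omega> in M. \<forall>i\<in>{1..n}. T i \<omega> > 0"
    by (subst AE_ball_countable) (use positive in auto)
  thus ?thesis
  proof eventually_elim
    case (elim \<omega>)
    show ?case unfolding event_time_def by (rule sum_nonneg) (use elim in \<open>blast intro: less_imp_le\<close>)
  qed
qed

text \<open>The last inter-arrival time is independent of the sum of the earlier ones.\<close>

lemma distr_event_time_Suc:
  "distr M borel (event_time T (Suc n)) = convolution interarrival (distr M borel (event_time T n))"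
proof -
  have "indep_var borel (T (Suc n)) borel (\<lambda>\<omega>. \<Sum>i\<in>{1..n}. T i \<omega>)"
    by (intro indep_vars_sum indep_vars_subset[OF indep]) auto
  hence "distr M borel (\<lambda>\<omega>. T (Suc n) \<omega> + event_time T n \<omega>)
      = convolution (distr M borel (T (Suc n))) (distr M borel (event_time T n))"
    by (intro sum_indep_random_variable measurable_T measurable_event_time) (auto simp: event_time_def[abs_def])
  moreover have "(\<lambda>\<omega>. T (Suc n) \<omega> + event_time T n \<omega>) = event_time T (Suc n)"
    by (auto simp: event_time_def)
  ultimately show ?thesis using ident_distr[of "Suc n"] by (simp add: interarrival_def)
qed

lemma nn_integral_event_time_Suc:
  assumes [measurable]: "f \<in> borel_measurable borel"
  shows "(\<integral>\<^sup>+\<omega>. f (event_time T (Suc n) \<omega>) \<partial>M)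
    = (\<integral>\<^sup>+y. \<integral>\<^sup>+\<omega>. f (y + event_time T n \<omega>) \<partial>M \<partial>interarrival)"
proof -
  interpret E: real_distribution "distr M borel (event_time T n)"
    by (intro real_distribution_distr) auto
  have "(\<integral>\<^sup>+\<omega>. f (event_time T (Suc n) \<omega>) \<partial>M) = (\<integral>\<^sup>+s. f s \<partial>distr M borel (event_time T (Suc n)))"
    by (simp add: nn_integral_distr)
  also have "\<dots> = (\<integral>\<^sup>+y. \<integral>\<^sup>+s. f (y + s) \<partial>distr M borel (event_time T n) \<partial>interarrival)"
    unfolding distr_event_time_Suc
    by (rule nn_integral_convolution)
       (simp_all add: interarrival.finite_measure_axioms E.finite_measure_axioms)
  also have "\<dots> = (\<integral>\<^sup>+y. \<integral>\<^sup>+\<omega>. f (y + event_time T n \<omega>) \<partial>M \<partial>interarrival)"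
    by (simp add: nn_integral_distr)
  finally show ?thesis .
qed

text \<open>The expected number of events in a set, the event at time 0 included.\<close>

definition renewal_measure :: "real measure" where
  "renewal_measure = distr (count_space UNIV \<Otimes>\<^sub>M M) borel (\<lambda>(n, \<omega>). event_time T n \<omega>)"

lemma sets_renewal_measure [simp, measurable_cong]: "sets renewal_measure = sets borel"
  by (simp add: renewal_measure_def)

lemma space_renewal_measure [simp]: "space renewal_measure = UNIV"
  by (simp add: renewal_measure_def)

lemma nn_integral_renewal_measure:
  assumes [measurable]: "f \<in> borel_measurable borel"
  shows "(\<integral>\<^sup>+s. f s \<partial>renewal_measure) = (\<Sum>n. \<integral>\<^sup>+\<omega>. f (event_time T n \<omega>) \<partial>M)"
proof -
  have [measurable]: "(\<lambda>(n, \<omega>). event_time T n \<omega>) \<in> borel_measurable (count_space UNIV \<Otimes>\<^sub>M M)"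
    by (rule measurable_pair_measure_countable1) auto
  have "(\<integral>\<^sup>+s. f s \<partial>renewal_measure) = (\<integral>\<^sup>+p. f ((\<lambda>(n, \<omega>). event_time T n \<omega>) p) \<partial>(count_space UNIV \<Otimes>\<^sub>M M))"
    unfolding renewal_measure_def by (rule nn_integral_distr) measurable
  also have "\<dots> = (\<integral>\<^sup>+n. \<integral>\<^sup>+\<omega>. f (event_time T n \<omega>) \<partial>M \<partial>count_space UNIV)"
    by (subst nn_integral_fst[symmetric]) auto
  finally show ?thesis by (simp add: nn_integral_count_space_nat)
qed

lemma emeasure_renewal_measure:
  assumes "A \<in> sets borel"
  shows "emeasure renewal_measure A = (\<Sum>n. emeasure M {\<omega>\<in>space M. event_time T n \<omega> \<in> A})"
proof -
  have "emeasure renewal_measure A = (\<integral>\<^sup>+s. indicator A s \<partial>renewal_measure)"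
    using assms by simp
  also have "\<dots> = (\<Sum>n. \<integral>\<^sup>+\<omega>. indicator A (event_time T n \<omega>) \<partial>M)"
    using assms by (intro nn_integral_renewal_measure) auto
  also have "\<dots> = (\<Sum>n. \<integral>\<^sup>+\<omega>. indicator {\<omega>\<in>space M. event_time T n \<omega> \<in> A} \<omega> \<partial>M)"
    by (intro suminf_cong nn_integral_cong) (auto simp: indicator_def)
  also have "\<dots> = (\<Sum>n. emeasure M {\<omega>\<in>space M. event_time T n \<omega> \<in> A})"
    using assms measurable_sets[OF measurable_event_time assms]
    by (intro suminf_cong nn_integral_indicator) (auto simp: vimage_def Int_def conj_commute)
  finally show ?thesis .
qed

lemma AE_renewal_measure:
  assumes [measurable]: "Measurable.pred borel P" and AE: "\<And>n. AE \<omega> in M. P (event_time T n \<omega>)"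
  shows "AE s in renewal_measure. P s"
proof (rule AE_I')
  have "emeasure M {\<omega> \<in> space M. event_time T n \<omega> \<in> {s. \<not> P s}} = 0" for n
    using AE[of n] by (subst (asm) AE_iff_measurable[OF _ refl]) auto
  hence "emeasure renewal_measure {s. \<not> P s} = 0"
    by (subst emeasure_renewal_measure) (auto simp: measurable_def pred_def)
  thus "{s. \<not> P s} \<in> null_sets renewal_measure" by (auto simp: null_sets_def)
qed auto

text \<open>The term \<open>n = 0\<close> of the series gives \<open>f 0\<close>; for the others one
  inter-arrival time is split off, and the remaining sum is again distributed as an event time with
  index lowered by one.\<close>

lemma renewal_equation:
  assumes [measurable]: "f \<in> borel_measurable borel"
  shows "(\<integral>\<^sup>+s. f s \<partial>renewal_measure)
    = f 0 + (\<integral>\<^sup>+y. \<integral>\<^sup>+s. f (y + s) \<partial>renewal_measure \<partial>interarrival)"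
proof -
  define I where "I n = (\<integral>\<^sup>+\<omega>. f (event_time T n \<omega>) \<partial>M)" for n
  have "(\<integral>\<^sup>+y. \<integral>\<^sup>+s. f (y + s) \<partial>renewal_measure \<partial>interarrival)
      = (\<integral>\<^sup>+y. (\<Sum>n. \<integral>\<^sup>+\<omega>. f (y + event_time T n \<omega>) \<partial>M) \<partial>interarrival)"
    by (intro nn_integral_cong nn_integral_renewal_measure) measurable
  also have "\<dots> = (\<Sum>n. I (Suc n))"
    unfolding I_def by (subst nn_integral_suminf) (auto simp: nn_integral_event_time_Suc)
  finally have "(\<lambda>n. I (Suc n)) sums (\<integral>\<^sup>+y. \<integral>\<^sup>+s. f (y + s) \<partial>renewal_measure \<partial>interarrival)"
    by (simp add: summable_sums summableI)
  from sums_Suc[OF this] have "suminf I = (\<integral>\<^sup>+y. \<integral>\<^sup>+s. f (y + s) \<partial>renewal_measure \<partial>interarrival) + I 0"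
    by (rule sums_unique[symmetric])
  moreover have "I 0 = f 0" by (simp add: I_def emeasure_space_1)
  ultimately show ?thesis by (simp add: nn_integral_renewal_measure I_def[abs_def] add.commute)
qed

lemma AE_renewal_measure_nonneg: "AE s in renewal_measure. s \<ge> 0"
  by (rule AE_renewal_measure) (auto intro: AE_event_time_nonneg)

lemma emeasure_renewal_measure_atMost_finite: "emeasure renewal_measure {..x} < \<infinity>"
proof -
  \<comment> \<open>Chernoff bound: \<open>E exp (- S\<^sub>n) = \<theta>\<^sup>n\<close> with \<open>\<theta> < 1\<close>, which is summable.\<close>
  define \<theta> where "\<theta> = (\<integral>y. exp (- y) \<partial>interarrival)"
  have AEb: "AE y in interarrival. norm (exp (- y)) \<le> 1" using AE_interarrival_pos by eventually_elim auto
  have int: "integrable interarrival (\<lambda>y. exp (- y))"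
    by (rule interarrival.integrable_const_bound[OF AEb]) auto
  have \<theta>0: "\<theta> \<ge> 0" unfolding \<theta>_def by (intro integral_nonneg_AE) auto
  have "\<theta> < (\<integral>y. 1 \<partial>interarrival)" unfolding \<theta>_def
    by (rule interarrival.integral_less_AE_space[OF int])
       (use AE_interarrival_pos in \<open>auto simp: interarrival.emeasure_space_1[unfolded interarrival.space_eq_univ]\<close>)
  hence \<theta>1: "\<theta> < 1" by (simp add: interarrival.prob_space[unfolded interarrival.space_eq_univ])
  have \<theta>nn: "(\<integral>\<^sup>+y. ennreal (exp (- y)) \<partial>interarrival) = ennreal \<theta>"
    unfolding \<theta>_def by (rule nn_integral_eq_integral[OF int]) auto
  have pow: "(\<integral>\<^sup>+\<omega>. ennreal (exp (- event_time T n \<omega>)) \<partial>M) = ennreal (\<theta> ^ n)" for n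
  proof (induction n)
    case 0
    thus ?case by (simp add: emeasure_space_1)
  next
    case (Suc n)
    have "(\<integral>\<^sup>+\<omega>. ennreal (exp (- event_time T (Suc n) \<omega>)) \<partial>M)
        = (\<integral>\<^sup>+y. \<integral>\<^sup>+\<omega>. ennreal (exp (- (y + event_time T n \<omega>))) \<partial>M \<partial>interarrival)"
      by (rule nn_integral_event_time_Suc) auto
    also have "\<dots> = (\<integral>\<^sup>+y. \<integral>\<^sup>+\<omega>. ennreal (exp (- y)) * ennreal (exp (- event_time T n \<omega>)) \<partial>M \<partial>interarrival)"
      by (intro nn_integral_cong) (simp add: ennreal_mult[symmetric] exp_add[symmetric])
    also have "\<dots> = ennreal \<theta> * ennreal (\<theta> ^ n)"
      by (simp add: nn_integral_cmult nn_integral_multc Suc \<theta>nn)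
    finally show ?case using \<theta>0 by (simp add: ennreal_mult)
  qed
  have "emeasure renewal_measure {..x} = (\<integral>\<^sup>+s. indicator {..x} s \<partial>renewal_measure)" by simp
  also have "\<dots> \<le> (\<integral>\<^sup>+s. ennreal (exp x) * ennreal (exp (- s)) \<partial>renewal_measure)"
    by (intro nn_integral_mono) (auto simp: indicator_def ennreal_mult[symmetric] exp_add[symmetric])
  also have "\<dots> = ennreal (exp x) * (\<Sum>n. ennreal (\<theta> ^ n))"
    by (simp add: nn_integral_cmult nn_integral_renewal_measure pow)
  also have "(\<Sum>n. ennreal (\<theta> ^ n)) = ennreal (\<Sum>n. \<theta> ^ n)"
    using \<theta>0 \<theta>1 by (intro suminf_ennreal2) (auto intro: summable_geometric)
  also have "ennreal (exp x) * \<dots> < \<infinity>" by (simp add: ennreal_mult_less_top)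
  finally show ?thesis .
qed

lemma emeasure_renewal_measure_bounded_finite:
  assumes "A \<subseteq> {..x}"
  shows "emeasure renewal_measure A < \<infinity>"
  by (rule le_less_trans[OF emeasure_mono[OF assms] emeasure_renewal_measure_atMost_finite]) simp

sublocale renewal_measure: sigma_finite_measure renewal_measure
proof
  have "(\<Union>n::nat. {..real n}) = UNIV" by (auto simp: real_arch_simple)
  thus "\<exists>A. countable A \<and> A \<subseteq> sets renewal_measure \<and> \<Union> A = space renewal_measure \<and>
      (\<forall>a\<in>A. emeasure renewal_measure a \<noteq> \<infinity>)"
    using emeasure_renewal_measure_atMost_finite
    by (intro exI[of _ "range (\<lambda>n::nat. {..real n})"]) (auto simp: less_top)
qed

section \<open>The tail of the inter-arrival law and uniform bounds for windows\<close>

lemma cdf_interarrival_measurable [measurable]: "cdf interarrival \<in> borel_measurable borel"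
  by (rule borel_measurable_mono) (simp add: mono_def interarrival.cdf_nondecreasing)

text \<open>Cutting off at negative arguments builds the restriction \<open>s \<le> x\<close> into
  \<open>tail (x - s)\<close>.\<close>

definition tail :: "real \<Rightarrow> real" where
  "tail y = (if y \<ge> 0 then interarrival.prob {y<..} else 0)"

lemma tail_nonneg: "tail y \<ge> 0" by (simp add: tail_def)

lemma tail_le_1: "tail y \<le> 1" by (simp add: tail_def)

lemma tail_antimono: "0 \<le> x \<Longrightarrow> x \<le> y \<Longrightarrow> tail y \<le> tail x"
  by (auto simp: tail_def intro!: interarrival.finite_measure_mono)

lemma tail_measurable [measurable]: "tail \<in> borel_measurable borel"
proof -
  have "interarrival.prob {y<..} = 1 - cdf interarrival y" for y
  proof -
    have "{y<..} = UNIV - {..y}" by auto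
    thus ?thesis unfolding cdf_def using interarrival.prob_compl[of "{..y}"] by simp
  qed
  hence tail_eq: "tail = (\<lambda>y. if y \<ge> 0 then 1 - cdf interarrival y else 0)"
    by (auto simp: tail_def)
  show ?thesis unfolding tail_eq by measurable
qed

text \<open>The mass of \<open>{..x}\<close> is computed twice. The renewal equation gives
  \<open>1 + H\<close>, where \<open>H\<close> integrates the probability that the next event also
  falls into \<open>{..x}\<close>. Splitting 1 into this probability and its complement gives
  \<open>H\<close> plus the wanted integral.\<close>

lemma nn_integral_tail_renewal_measure:
  assumes "x \<ge> 0"
  shows "(\<integral>\<^sup>+s. ennreal (tail (x - s)) \<partial>renewal_measure) = 1"
proof -
  have pair: "pair_sigma_finite interarrival renewal_measure"
    by (intro pair_sigma_finite.intro interarrival.sigma_finite_measure renewal_measure.sigma_finite_measure_axioms)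
  define H where "H = (\<integral>\<^sup>+s. indicator {..x} s * emeasure interarrival {..x - s} \<partial>renewal_measure)"
  have [measurable]: "(\<lambda>s. emeasure interarrival {..x - s}) \<in> borel_measurable borel"
  proof -
    have "(\<lambda>s. ennreal (cdf interarrival (x - s))) \<in> borel_measurable borel" by measurable
    thus ?thesis by (simp add: cdf_def interarrival.emeasure_eq_measure)
  qed
  have AEpos: "emeasure interarrival {..z} = 0" if "z < 0" for z
  proof -
    have "AE y in interarrival. y \<notin> {..z}" using AE_interarrival_pos by eventually_elim (use that in auto)
    thus ?thesis by (subst (asm) AE_iff_null_sets[symmetric]) auto
  qed
  have H: "emeasure renewal_measure {..x} = 1 + H"
  proof -
    have "emeasure renewal_measure {..x} = (\<integral>\<^sup>+s. indicator {..x} s \<partial>renewal_measure)" by simp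
    also have "\<dots> = indicator {..x} 0 + (\<integral>\<^sup>+y. \<integral>\<^sup>+s. indicator {..x} (y + s) \<partial>renewal_measure \<partial>interarrival)"
      by (rule renewal_equation) auto
    also have "(\<integral>\<^sup>+y. \<integral>\<^sup>+s. indicator {..x} (y + s) \<partial>renewal_measure \<partial>interarrival)
        = (\<integral>\<^sup>+s. \<integral>\<^sup>+y. indicator {..x} (y + s) \<partial>interarrival \<partial>renewal_measure)"
      by (rule pair_sigma_finite.Fubini'[OF pair, symmetric]) measurable
    also have "\<dots> = (\<integral>\<^sup>+s. \<integral>\<^sup>+y. indicator {..x - s} y \<partial>interarrival \<partial>renewal_measure)"
      by (intro nn_integral_cong) (auto simp: indicator_def)
    also have "\<dots> = (\<integral>\<^sup>+s. emeasure interarrival {..x - s} \<partial>renewal_measure)"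
      by simp
    \<comment> \<open>For \<open>s > x\<close> the inner mass is that of a negative half-line, so
      inserting the indicator changes nothing.\<close>
    also have "\<dots> = H"
      unfolding H_def by (intro nn_integral_cong) (auto simp: indicator_def AEpos)
    finally show ?thesis using assms by simp
  qed
  have split: "emeasure interarrival {..y} + ennreal (tail y) = 1" if "y \<ge> 0" for y
  proof -
    have "emeasure interarrival {..y} + emeasure interarrival {y<..} = emeasure interarrival ({..y} \<union> {y<..})"
      by (rule plus_emeasure) auto
    also have "{..y} \<union> {y<..} = UNIV" by auto
    finally show ?thesis
      using that interarrival.emeasure_space_1 by (simp add: tail_def interarrival.emeasure_eq_measure)
  qed
  have "emeasure renewal_measure {..x} = (\<integral>\<^sup>+s. indicator {..x} s \<partial>renewal_measure)" by simp
  also have "\<dots> = (\<integral>\<^sup>+s. indicator {..x} s * emeasure interarrival {..x - s} + ennreal (tail (x - s)) \<partial>renewal_measure)"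
    by (intro nn_integral_cong) (auto simp: indicator_def split, auto simp: tail_def)
  also have "\<dots> = H + (\<integral>\<^sup>+s. ennreal (tail (x - s)) \<partial>renewal_measure)"
    unfolding H_def by (rule nn_integral_add) measurable
  finally have "H + (\<integral>\<^sup>+s. ennreal (tail (x - s)) \<partial>renewal_measure) = H + 1"
    using H by (simp add: add.commute)
  \<comment> \<open>Cancelling \<open>H\<close> in the extended reals requires its
    finiteness.\<close>
  moreover have "H \<noteq> \<infinity>"
    using H emeasure_renewal_measure_atMost_finite[of x] by (auto simp: less_top)
  ultimately show ?thesis by (simp add: ennreal_add_left_cancel)
qed

text \<open>Otherwise the law would give no mass to any of the rays beyond
  \<open>1 / (n + 1)\<close>, hence none to the positive half-line.\<close>

lemma ex_tail_pos: "\<exists>h>0. tail h > 0"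
proof (rule ccontr)
  assume "\<not> ?thesis"
  hence "tail (1 / real (Suc n)) = 0" for n
    using tail_nonneg[of "1 / real (Suc n)"] by (metis less_le of_nat_0_less_iff zero_less_Suc zero_less_divide_1_iff)
  hence "emeasure interarrival {1 / real (Suc n)<..} = 0" for n
    by (simp add: tail_def interarrival.emeasure_eq_measure)
  hence "{1 / real (Suc n)<..} \<in> null_sets interarrival" for n by (simp add: null_sets_def)
  hence "AE y in interarrival. y \<notin> {1 / real (Suc n)<..}" for n by (rule AE_not_in)
  hence "AE y in interarrival. \<forall>n. y \<notin> {1 / real (Suc n)<..}" by (subst AE_all_countable) auto
  with AE_interarrival_pos have "AE y in interarrival. False"
  proof eventually_elim
    case (elim y)
    then obtain n where "1 / real (Suc n) < y" using nat_approx_posE by blast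
    thus ?case using elim by auto
  qed
  thus False by simp
qed

text \<open>On a window of length \<open>h\<close> ending at \<open>x\<close> the integrand
  \<open>tail (x - s)\<close> is at least \<open>tail h\<close>, while its integral is 1. This
  bounds the mass of such windows uniformly in \<open>x\<close>, and \<open>N\<close> of them cover
  a window of half-width \<open>l\<close>.\<close>

lemma emeasure_renewal_measure_window_bounded:
  "\<exists>C\<ge>0. \<forall>x. emeasure renewal_measure {x - l..x + l} \<le> ennreal C"
proof -
  obtain h where h: "h > 0" "tail h > 0" using ex_tail_pos by blast
  have window: "emeasure renewal_measure {x - h..x} \<le> ennreal (1 / tail h)" for x
  proof (cases "x \<ge> 0")
    case True
    have "ennreal (tail h) * emeasure renewal_measure {x - h..x}
        = (\<integral>\<^sup>+s. ennreal (tail h) * indicator {x - h..x} s \<partial>renewal_measure)"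
      by (simp add: nn_integral_cmult_indicator)
    also have "\<dots> \<le> (\<integral>\<^sup>+s. ennreal (tail (x - s)) \<partial>renewal_measure)"
      by (intro nn_integral_mono) (auto simp: indicator_def intro!: ennreal_leI tail_antimono)
    also have "\<dots> = 1" using True by (rule nn_integral_tail_renewal_measure)
    finally have le: "ennreal (tail h) * emeasure renewal_measure {x - h..x} \<le> 1" .
    have "emeasure renewal_measure {x - h..x}
        = ennreal (1 / tail h) * (ennreal (tail h) * emeasure renewal_measure {x - h..x})"
      using h by (simp add: mult.assoc[symmetric] ennreal_mult[symmetric])
    also have "\<dots> \<le> ennreal (1 / tail h) * 1" by (intro mult_left_mono le) auto
    finally show ?thesis by simp
  next
    case False
    have "AE s in renewal_measure. s \<notin> {x - h..x}"
      using AE_renewal_measure_nonneg by eventually_elim (use False in auto)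
    hence "emeasure renewal_measure {x - h..x} = 0"
      by (subst (asm) AE_iff_null_sets[symmetric]) auto
    thus ?thesis by simp
  qed
  obtain N :: nat where N: "2 * l < real N * h" using reals_Archimedean3[OF h(1)] by blast
  have "emeasure renewal_measure {x - l..x + l} \<le> ennreal (real N * (1 / tail h))" for x
  proof -
    let ?W = "\<lambda>k. {(x + l - real k * h) - h..x + l - real k * h}"
    have "{x - l..x + l} \<subseteq> (\<Union>k<N. ?W k)"
    proof
      fix s assume s: "s \<in> {x - l..x + l}"
      \<comment> \<open>The number of whole steps \<open>h\<close> from the right end of the window
        down to \<open>s\<close>.\<close>
      define k where "k = nat \<lfloor>(x + l - s) / h\<rfloor>"
      have nn: "(x + l - s) / h \<ge> 0" using s h by auto
      have k: "real k \<le> (x + l - s) / h" "(x + l - s) / h < real k + 1"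
        using nn unfolding k_def by linarith+
      have "(x + l - s) / h < real N" using s N h by (auto simp: field_simps)
      hence "k < N" using k by linarith
      moreover have "s \<in> ?W k" using k h by (auto simp: field_simps)
      ultimately show "s \<in> (\<Union>k<N. ?W k)" by blast
    qed
    hence "emeasure renewal_measure {x - l..x + l} \<le> emeasure renewal_measure (\<Union>k<N. ?W k)"
      by (intro emeasure_mono) auto
    also have "\<dots> \<le> (\<Sum>k<N. emeasure renewal_measure (?W k))"
      by (intro emeasure_subadditive_finite) auto
    also have "\<dots> \<le> (\<Sum>k<N. ennreal (1 / tail h))" by (intro sum_mono window)
    also have "\<dots> = ennreal (real N * (1 / tail h))" using h by (simp add: ennreal_of_nat_eq_real_of_nat ennreal_mult[symmetric])
    finally show ?thesis .
  qed
  thus ?thesis using h by (intro exI[of _ "real N * (1 / tail h)"]) auto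
qed

end

section \<open>Smoothing with triangular kernels\<close>

lemma closed_multiples: "closed (range (\<lambda>k::int. of_int k * d :: real))"
proof -
  have "range (\<lambda>k::int. of_int k * d) = (\<lambda>x. d *\<^sub>R x) ` (\<int> :: real set)"
    by (auto simp: Ints_def mult.commute image_image)
  thus ?thesis using closed_scaling[OF closed_Ints, of d] by metis
qed

text \<open>The triangular kernel \<Lambda>. For \<open>w > 0\<close>, its translates by all integer
  multiples of \<open>w\<close> sum to 1, so combinations of them interpolate linearly between grid
  points.\<close>

definition tent :: "real \<Rightarrow> real \<Rightarrow> real" where
  "tent w y = max 0 (1 - \<bar>y\<bar> / w)"

lemma tent_nonneg: "0 \<le> tent w y"
  by (simp add: tent_def)

lemma tent_le_1: "w > 0 \<Longrightarrow> tent w y \<le> 1"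
  by (simp add: tent_def)

lemma tent_eq_0: "w > 0 \<Longrightarrow> w \<le> \<bar>y\<bar> \<Longrightarrow> tent w y = 0"
  by (simp add: tent_def)

lemma tent_measurable [measurable]: "tent w \<in> borel_measurable borel"
  unfolding tent_def[abs_def] by measurable

lemma tent_lipschitz:
  assumes "w > 0"
  shows "\<bar>tent w x - tent w y\<bar> \<le> \<bar>x - y\<bar> / w"
proof -
  have "\<bar>tent w x - tent w y\<bar> \<le> \<bar>\<bar>x\<bar> / w - \<bar>y\<bar> / w\<bar>" unfolding tent_def by linarith
  also have "\<dots> = \<bar>\<bar>x\<bar> - \<bar>y\<bar>\<bar> / w" using assms by (simp add: diff_divide_distrib[symmetric])
  also have "\<dots> \<le> \<bar>x - y\<bar> / w" using assms by (intro divide_right_mono) auto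
  finally show ?thesis .
qed

text \<open>Only the kernels centred at the two neighbouring grid points are nonzero; their values
  are the weights of linear interpolation.\<close>

lemma tent_sums_nonneg:
  assumes "w > 0" "0 \<le> \<theta>" "\<theta> \<le> 1"
  shows "(\<lambda>k. c k * tent w ((real j + \<theta>) * w - real k * w)) sums (c j * (1 - \<theta>) + c (Suc j) * \<theta>)"
proof -
  have t: "tent w ((real j + \<theta>) * w - real k * w) = max 0 (1 - \<bar>real j + \<theta> - real k\<bar>)" for k
  proof -
    have "(real j + \<theta>) * w - real k * w = (real j + \<theta> - real k) * w" by (simp add: algebra_simps)
    thus ?thesis using assms by (simp add: tent_def abs_mult)
  qed
  have "c k * max 0 (1 - \<bar>real j + \<theta> - real k\<bar>) = 0" if "k \<notin> {j, Suc j}" for k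
  proof -
    \<comment> \<open>The conjunct \<open>j \<ge> 1\<close> guards against truncated
      subtraction.\<close>
    have "k \<le> j - 1 \<and> j \<ge> 1 \<or> k \<ge> j + 2" using that by auto
    hence "real k \<le> real j - 1 \<or> real k \<ge> real j + 2" by linarith
    hence "1 - \<bar>real j + \<theta> - real k\<bar> \<le> 0" using assms by linarith
    thus ?thesis by simp
  qed
  hence "(\<lambda>k. c k * max 0 (1 - \<bar>real j + \<theta> - real k\<bar>)) sums
      (\<Sum>k\<in>{j, Suc j}. c k * max 0 (1 - \<bar>real j + \<theta> - real k\<bar>))"
    by (intro sums_finite) auto
  also have "(\<Sum>k\<in>{j, Suc j}. c k * max 0 (1 - \<bar>real j + \<theta> - real k\<bar>)) = c j * (1 - \<theta>) + c (Suc j) * \<theta>"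
  proof -
    have "1 - \<bar>real j + \<theta> - real (Suc j)\<bar> = \<theta>" using assms by simp
    thus ?thesis using assms by simp
  qed
  finally show ?thesis by (simp add: t)
qed

lemma tent_sums_nonpos:
  assumes "w > 0" "y \<le> 0"
  shows "(\<lambda>k. c k * tent w (y - real k * w)) sums (c 0 * tent w y)"
proof -
  have "c k * tent w (y - real k * w) = 0" if "k \<notin> {0}" for k
  proof -
    have "1 * w \<le> real k * w" using that assms by (intro mult_right_mono) auto
    hence "w \<le> \<bar>y - real k * w\<bar>" using assms by linarith
    hence "tent w (y - real k * w) = 0" using assms by (intro tent_eq_0) auto
    thus ?thesis by simp
  qed
  hence "(\<lambda>k. c k * tent w (y - real k * w)) sums (\<Sum>k\<in>{0}. c k * tent w (y - real k * w))"
    by (intro sums_finite) auto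
  thus ?thesis by simp
qed

lemma nonneg_grid_decompose:
  assumes "w > 0" "y \<ge> 0"
  obtains j :: nat and \<theta> :: real where "y = (real j + \<theta>) * w" "0 \<le> \<theta>" "\<theta> < 1"
proof
  have "y / w \<ge> 0" using assms by simp
  hence "real (nat \<lfloor>y / w\<rfloor>) + frac (y / w) = y / w" by (simp add: frac_def)
  thus "y = (real (nat \<lfloor>y / w\<rfloor>) + frac (y / w)) * w" using assms by simp
qed (auto simp: frac_lt_1)

text \<open>For \<open>w > 0\<close> this is the piecewise linear interpolant with value
  \<open>c k\<close> at \<open>k * w\<close>. To the left of 0 it does not jump to 0 but descends
  linearly on \<open>[-w, 0]\<close>.\<close>

definition grid_sum :: "real \<Rightarrow> (nat \<Rightarrow> real) \<Rightarrow> real \<Rightarrow> real" where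
  "grid_sum w c y = (\<Sum>k. c k * tent w (y - real k * w))"

lemma grid_sum_nonneg:
  assumes "w > 0" "0 \<le> \<theta>" "\<theta> \<le> 1"
  shows "grid_sum w c ((real j + \<theta>) * w) = c j * (1 - \<theta>) + c (Suc j) * \<theta>"
  unfolding grid_sum_def using tent_sums_nonneg[OF assms] by (rule sums_unique[symmetric])

lemma grid_sum_nonpos:
  assumes "w > 0" "y \<le> 0"
  shows "grid_sum w c y = c 0 * tent w y"
  unfolding grid_sum_def using tent_sums_nonpos[OF assms] by (rule sums_unique[symmetric])

text \<open>On the grid the interpolant is exact, which removes all sandwiching in the arithmetic
  case.\<close>

lemma grid_sum_mult:
  assumes "w > 0"
  shows "grid_sum w c (of_int k * w) = (if k \<ge> 0 then c (nat k) else 0)"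
proof (cases "k \<ge> 0")
  case True
  thus ?thesis using grid_sum_nonneg[OF assms, of 0 c "nat k"] by simp
next
  case False
  hence "of_int k * w \<le> -1 * w" using assms by (intro mult_right_mono) auto
  thus ?thesis using False assms by (simp add: grid_sum_nonpos tent_eq_0)
qed

section \<open>The smoothed renewal density: boundedness, Lipschitz continuity, averaging\<close>

context renewal_process
begin

text \<open>The function \<open>Z\<close>, left unnormalised: the kernel has integral
  \<open>w\<close>, so in the non-arithmetic case the limit to expect is
  \<open>w / t\<close>.\<close>

definition smoothed_density :: "real \<Rightarrow> real \<Rightarrow> real" where
  "smoothed_density w x = (\<integral>s. tent w (x - s) \<partial>renewal_measure)"

lemma integrable_supported:
  fixes f :: "real \<Rightarrow> real"
  assumes [measurable]: "f \<in> borel_measurable borel" and "\<And>s. \<bar>f s\<bar> \<le> B" "\<And>s. s > b \<Longrightarrow> f s = 0"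
  shows "integrable renewal_measure f"
proof (rule Bochner_Integration.integrable_bound)
  show "integrable renewal_measure (\<lambda>s. B * indicator {..b} s)"
    using emeasure_renewal_measure_atMost_finite[of b]
    by (intro integrable_mult_right integrable_real_indicator) auto
  have "norm (f s) \<le> norm (B * indicator {..b} s)" for s
    using assms(2)[of s] assms(3)[of s] by (cases "s \<le> b") auto
  thus "AE s in renewal_measure. norm (f s) \<le> norm (B * indicator {..b} s)" by simp
qed measurable

lemma integrable_tent: "w > 0 \<Longrightarrow> integrable renewal_measure (\<lambda>s. tent w (x - s))"
  by (rule integrable_supported[of _ 1 "x + w"]) (auto simp: tent_le_1 tent_nonneg tent_eq_0)

lemma smoothed_density_nonneg: "smoothed_density w x \<ge> 0"
  unfolding smoothed_density_def by (intro integral_nonneg_AE) (auto simp: tent_nonneg)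

lemma measure_renewal_measure_window_bounded:
  "\<exists>C\<ge>0. \<forall>x. measure renewal_measure {x - l..x + l} \<le> C"
proof -
  from emeasure_renewal_measure_window_bounded[of l] obtain C
    where C: "C \<ge> 0" "\<And>x. emeasure renewal_measure {x - l..x + l} \<le> ennreal C" by blast
  have "measure renewal_measure {x - l..x + l} \<le> C" for x
    unfolding measure_def using enn2real_mono[OF C(2)[of x]] C(1) by simp
  thus ?thesis using C(1) by blast
qed

lemma integrable_indicator_window: "integrable renewal_measure (\<lambda>s. indicator {a..b} s :: real)"
  by (intro integrable_real_indicator emeasure_renewal_measure_bounded_finite[of _ b]) auto

lemma smoothed_density_bounded:
  assumes w: "w > 0"
  shows "\<exists>B\<ge>0. \<forall>x. smoothed_density w x \<le> B"
proof -
  obtain C where C: "C \<ge> 0" "\<And>x. measure renewal_measure {x - w..x + w} \<le> C"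
    using measure_renewal_measure_window_bounded by blast
  have "smoothed_density w x \<le> C" for x
  proof -
    have "smoothed_density w x \<le> (\<integral>s. indicator {x - w..x + w} s \<partial>renewal_measure)"
      unfolding smoothed_density_def
    proof (intro integral_mono integrable_tent w integrable_indicator_window)
      show "tent w (x - s) \<le> indicator {x - w..x + w} s" for s
        using tent_le_1[OF w, of "x - s"] tent_eq_0[OF w, of "x - s"] by (auto simp: indicator_def)
    qed
    also have "\<dots> = measure renewal_measure {x - w..x + w}" by simp
    finally show ?thesis using C(2)[of x] by linarith
  qed
  thus ?thesis using C by blast
qed

text \<open>The difference of the two kernels is at most \<open>\<bar>x - y\<bar> / w\<close> and
  vanishes outside the windows around \<open>x\<close> and \<open>y\<close>, each of mass at most
  \<open>C\<close>.\<close>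

lemma smoothed_density_lipschitz:
  assumes w: "w > 0"
  shows "\<exists>L. L-lipschitz_on UNIV (smoothed_density w)"
proof -
  obtain C where C: "C \<ge> 0" "\<And>x. measure renewal_measure {x - w..x + w} \<le> C"
    using measure_renewal_measure_window_bounded by blast
  have "(2 * C / w)-lipschitz_on UNIV (smoothed_density w)"
  proof (rule lipschitz_onI)
    fix x y :: real
    let ?I = "\<lambda>x. (indicator {x - w..x + w} :: real \<Rightarrow> real)"
    have le: "\<bar>tent w (x - s) - tent w (y - s)\<bar> \<le> \<bar>x - y\<bar> / w * (?I x s + ?I y s)" for s
    proof (cases "s \<in> {x - w..x + w} \<union> {y - w..y + w}")
      case True
      have "\<bar>tent w (x - s) - tent w (y - s)\<bar> \<le> \<bar>x - y\<bar> / w * 1"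
        using tent_lipschitz[OF w, of "x - s" "y - s"] by simp
      also have "\<dots> \<le> \<bar>x - y\<bar> / w * (?I x s + ?I y s)"
        using True w by (intro mult_left_mono) (auto simp: indicator_def)
      finally show ?thesis .
    next
      case False
      thus ?thesis using tent_eq_0[OF w, of "x - s"] tent_eq_0[OF w, of "y - s"] by (auto simp: abs_if)
    qed
    have "dist (smoothed_density w x) (smoothed_density w y)
        = \<bar>\<integral>s. tent w (x - s) - tent w (y - s) \<partial>renewal_measure\<bar>"
      unfolding dist_real_def smoothed_density_def
      by (subst Bochner_Integration.integral_diff) (auto intro: integrable_tent w)
    also have "\<dots> \<le> (\<integral>s. \<bar>tent w (x - s) - tent w (y - s)\<bar> \<partial>renewal_measure)"
      by (rule integral_abs_bound)
    also have "\<dots> \<le> (\<integral>s. \<bar>x - y\<bar> / w * (?I x s + ?I y s) \<partial>renewal_measure)"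
      by (intro integral_mono integrable_abs Bochner_Integration.integrable_diff integrable_tent w
          integrable_mult_right Bochner_Integration.integrable_add integrable_indicator_window le)
    also have "\<dots> = \<bar>x - y\<bar> / w * (\<integral>s. ?I x s + ?I y s \<partial>renewal_measure)" by (rule integral_mult_right_zero)
    also have "(\<integral>s. ?I x s + ?I y s \<partial>renewal_measure)
        = measure renewal_measure {x - w..x + w} + measure renewal_measure {y - w..y + w}"
      by (subst Bochner_Integration.integral_add[OF integrable_indicator_window integrable_indicator_window]) simp
    also have "\<bar>x - y\<bar> / w * \<dots> \<le> \<bar>x - y\<bar> / w * (2 * C)"
      using C(2)[of x] C(2)[of y] w by (intro mult_left_mono) auto
    finally show "dist (smoothed_density w x) (smoothed_density w y) \<le> 2 * C / w * dist x y"
      by (simp add: dist_real_def mult_ac)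
  qed (use C w in auto)
  thus ?thesis ..
qed

lemma nn_integral_tent:
  assumes "w > 0"
  shows "(\<integral>\<^sup>+s. ennreal (tent w (x - s)) \<partial>renewal_measure) = ennreal (smoothed_density w x)"
  unfolding smoothed_density_def
  by (intro nn_integral_eq_integral integrable_tent assms) (auto simp: tent_nonneg)

lemma smoothed_density_measurable [measurable]:
  assumes "w > 0"
  shows "smoothed_density w \<in> borel_measurable borel"
proof -
  obtain L where "L-lipschitz_on UNIV (smoothed_density w)" using smoothed_density_lipschitz[OF assms] ..
  thus ?thesis by (intro borel_measurable_continuous_onI lipschitz_on_continuous_on)
qed

text \<open>This is the renewal equation for the kernel; the contribution of the event at time 0 is
  \<open>tent w x\<close>, which vanishes once \<open>x \<ge> w\<close>.\<close>

lemma smoothed_density_harmonic: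
  assumes w: "w > 0" and "x \<ge> w"
  shows "smoothed_density w x = (\<integral>y. smoothed_density w (x - y) \<partial>interarrival)"
proof -
  note [measurable] = smoothed_density_measurable[OF w]
  have "ennreal (smoothed_density w x) = (\<integral>\<^sup>+s. ennreal (tent w (x - s)) \<partial>renewal_measure)"
    by (simp add: nn_integral_tent w)
  also have "\<dots> = ennreal (tent w (x - 0)) +
      (\<integral>\<^sup>+y. \<integral>\<^sup>+s. ennreal (tent w (x - (y + s))) \<partial>renewal_measure \<partial>interarrival)"
    by (rule renewal_equation) measurable
  also have "tent w (x - 0) = 0" using assms by (simp add: tent_eq_0)
  also have "(\<integral>\<^sup>+y. \<integral>\<^sup>+s. ennreal (tent w (x - (y + s))) \<partial>renewal_measure \<partial>interarrival)
      = (\<integral>\<^sup>+y. ennreal (smoothed_density w (x - y)) \<partial>interarrival)"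
    using nn_integral_tent[OF w, of "x - _"] by (simp add: diff_diff_eq)
  finally have "(\<integral>\<^sup>+y. ennreal (smoothed_density w (x - y)) \<partial>interarrival) = ennreal (smoothed_density w x)"
    by simp
  thus ?thesis
    by (subst integral_eq_nn_integral) (auto simp: smoothed_density_nonneg)
qed

section \<open>The group of shifts with asymptotically vanishing increments\<close>

definition increment_null :: "real \<Rightarrow> real set" where
  "increment_null w = {a. ((\<lambda>x. smoothed_density w (x + a) - smoothed_density w x) \<longlongrightarrow> 0) at_top}"

lemma increment_null_subgroup:
  assumes w: "w > 0"
  shows "closed (increment_null w)" "0 \<in> increment_null w"
    "\<And>a b. a \<in> increment_null w \<Longrightarrow> b \<in> increment_null w \<Longrightarrow> a - b \<in> increment_null w"
proof -
  obtain L where L: "L-lipschitz_on UNIV (smoothed_density w)" using smoothed_density_lipschitz[OF w] ..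
  note * = lipschitz_increment_closed_subgroup[OF L, folded increment_null_def]
  show "closed (increment_null w)" "0 \<in> increment_null w" by fact+
  show "a - b \<in> increment_null w" if "a \<in> increment_null w" "b \<in> increment_null w" for a b
    using that by (rule *(3))
qed

text \<open>A point all of whose balls have positive mass belongs to the set by the averaging
  argument, so every point outside has a null ball around it.\<close>

lemma AE_increment_null:
  assumes w: "w > 0"
  shows "AE y in interarrival. y \<in> increment_null w"
proof (rule interarrival.AE_mem_closed[OF increment_null_subgroup(1)[OF w]])
  fix a assume a: "a \<notin> increment_null w"
  obtain L where L: "L-lipschitz_on UNIV (smoothed_density w)" using smoothed_density_lipschitz[OF w] ..
  obtain B where B: "\<And>x. smoothed_density w x \<le> B" using smoothed_density_bounded[OF w] by blast
  show "\<exists>r>0. interarrival.prob (ball a r) = 0"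
  proof (rule ccontr)
    assume "\<not> ?thesis"
    hence pos: "interarrival.prob (ball a r) > 0" if "r > 0" for r
      using that measure_nonneg[of interarrival "ball a r"] by (auto simp: less_le)
    have "((\<lambda>x. smoothed_density w (x + a) - smoothed_density w x) \<longlongrightarrow> 0) at_top"
      by (rule interarrival.harmonic_increment_tendsto_0[OF _ L smoothed_density_harmonic[OF w] pos, of B])
         (auto simp: B smoothed_density_nonneg)
    thus False using a by (simp add: increment_null_def)
  qed
qed

text \<open>Positivity of the inter-arrival times supplies a positive element, so a proper closed
  subgroup is a lattice. It contains almost surely all inter-arrival times and, being closed under
  addition, all event times.\<close>

lemma closed_subgroup_lattice:
  assumes "closed H" "0 \<in> H" "\<And>a b. a \<in> H \<Longrightarrow> b \<in> H \<Longrightarrow> a - b \<in> H"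
    and AE: "AE y in interarrival. y \<in> H" and "H \<noteq> UNIV"
  shows "\<exists>c>0. H = range (\<lambda>k::int. of_int k * c) \<and> events_on_multiples M T c"
proof -
  have "\<exists>b. b \<in> H \<and> b > 0"
  proof (rule ccontr)
    assume no: "\<not> ?thesis"
    have "AE y in interarrival. False"
      using AE AE_interarrival_pos by eventually_elim (use no in blast)
    thus False by simp
  qed
  then obtain b where "b \<in> H" "b > 0" by blast
  with closed_additive_subgroup_real[OF assms(1-3) this] \<open>H \<noteq> UNIV\<close>
  obtain c where c: "c > 0" "H = range (\<lambda>k::int. of_int k * c)" by auto
  have add: "a + b \<in> H" if "a \<in> H" "b \<in> H" for a b
    using assms(3)[OF that(1) assms(3)[OF assms(2) that(2)]] by simp
  have "Measurable.pred borel (\<lambda>y. y \<in> H)" using \<open>closed H\<close> by (simp add: pred_def borel_closed)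
  hence "AE \<omega> in M. T i \<omega> \<in> H" if "i \<ge> 1" for i using AE that by (simp add: AE_interarrival_iff)
  hence "AE \<omega> in M. \<forall>i\<in>{1..}. T i \<omega> \<in> H" by (subst AE_ball_countable) auto
  hence "events_on_multiples M T c" unfolding events_on_multiples_def
  proof eventually_elim
    case (elim \<omega>)
    have "event_time T n \<omega> \<in> H" for n
      by (induction n) (use elim assms(2) add in \<open>auto simp: event_time_def\<close>)
    thus ?case unfolding c(2) by (auto simp: image_iff)
  qed
  thus ?thesis using c by blast
qed

lemma increment_null_nonarithmetic:
  assumes "w > 0" "\<not> arithmetic M T"
  shows "increment_null w = UNIV"
  using closed_subgroup_lattice[OF increment_null_subgroup[OF assms(1)] AE_increment_null[OF assms(1)]] assms
  by (auto simp: arithmetic_def)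

lemma AE_interarrival_multiple:
  assumes "events_on_multiples M T d"
  shows "AE y in interarrival. y \<in> range (\<lambda>k::int. of_int k * d)"
proof (subst AE_interarrival_iff[of _ 1])
  show "Measurable.pred borel (\<lambda>y. y \<in> range (\<lambda>k::int. of_int k * d))"
    using closed_multiples by (simp add: pred_def borel_closed)
  show "AE \<omega> in M. T 1 \<omega> \<in> range (\<lambda>k::int. of_int k * d)"
    using assms unfolding events_on_multiples_def
  proof eventually_elim
    case (elim \<omega>)
    hence "\<exists>k::int. event_time T 1 \<omega> = of_int k * d" by blast
    thus ?case by (auto simp: event_time_def)
  qed
qed auto

lemma AE_renewal_measure_multiple:
  assumes "events_on_multiples M T d"
  shows "AE s in renewal_measure. s \<in> range (\<lambda>k::int. of_int k * d)"
proof (rule AE_renewal_measure)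
  show "Measurable.pred borel (\<lambda>y. y \<in> range (\<lambda>k::int. of_int k * d))"
    using closed_multiples by (simp add: pred_def borel_closed)
  show "AE \<omega> in M. event_time T n \<omega> \<in> range (\<lambda>k::int. of_int k * d)" for n
    using assms unfolding events_on_multiples_def
  proof eventually_elim
    case (elim \<omega>)
    show ?case
    proof (cases "n = 0")
      case True
      thus ?thesis by (auto intro!: image_eqI[of _ _ 0])
    next
      case False
      hence "\<exists>k::int. event_time T n \<omega> = of_int k * d" using elim by auto
      thus ?thesis by auto
    qed
  qed
qed

text \<open>Intersecting with the multiples of \<open>d\<close> makes the subgroup proper whatever
  \<open>increment_null w\<close> is. The intersection is a lattice with generator \<open>c\<close>,
  a positive multiple of \<open>d\<close>, that carries the events; maximality of the span gives
  \<open>c \<le> d\<close>, so \<open>c = d\<close>.\<close>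

lemma increment_null_span:
  assumes w: "w > 0" and "has_span M T d"
  shows "d \<in> increment_null w"
proof -
  have d: "d > 0" "events_on_multiples M T d" "\<And>d'. d' > 0 \<Longrightarrow> events_on_multiples M T d' \<Longrightarrow> d' \<le> d"
    using assms(2) by (auto simp: has_span_def)
  let ?D = "range (\<lambda>k::int. of_int k * d)"
  define H where "H = increment_null w \<inter> ?D"
  have "d / 2 \<notin> ?D"
  proof
    assume "d / 2 \<in> ?D"
    then obtain k :: int where "d / 2 = of_int k * d" by auto
    hence "of_int (2 * k) = (1::real)" using d(1) by (simp add: field_simps)
    hence "2 * k = 1" by linarith
    thus False by presburger
  qed
  hence "H \<noteq> UNIV" by (auto simp: H_def)
  moreover have "closed H" unfolding H_def
    by (intro closed_Int increment_null_subgroup w closed_multiples)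
  moreover have "0 \<in> H" using increment_null_subgroup(2)[OF w] by (auto simp: H_def intro!: image_eqI[of _ _ 0])
  moreover have "a - b \<in> H" if "a \<in> H" "b \<in> H" for a b
  proof -
    from that obtain k l :: int where kl: "a = of_int k * d" "b = of_int l * d" by (auto simp: H_def)
    have "a - b = of_int (k - l) * d" by (simp add: kl algebra_simps)
    hence "a - b \<in> ?D" by blast
    thus ?thesis using that increment_null_subgroup(3)[OF w] by (auto simp: H_def)
  qed
  moreover have "AE y in interarrival. y \<in> H"
    using AE_increment_null[OF w] AE_interarrival_multiple[OF d(2)] by eventually_elim (simp add: H_def)
  ultimately obtain c where c: "c > 0" "H = range (\<lambda>k::int. of_int k * c)" "events_on_multiples M T c"
    using closed_subgroup_lattice[of H] by blast
  have "c \<in> H" unfolding c(2) by (auto intro!: image_eqI[of _ _ 1])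
  then obtain k :: int where k: "c = of_int k * d" by (auto simp: H_def)
  hence "k > 0" using c(1) d(1) by (simp add: zero_less_mult_iff)
  hence "1 * d \<le> of_int k * d" using d(1) by (intro mult_right_mono) auto
  hence "c = d" using d(3)[OF c(1,3)] k by simp
  thus ?thesis using \<open>c \<in> H\<close> by (simp add: H_def)
qed

end

section \<open>Identifying the limit\<close>

context renewal_process
begin

text \<open>Series and integral may be exchanged because the smoothed density is bounded and
  \<open>c\<close> is summable.\<close>

lemma grid_sum_renewal_integral:
  assumes w: "w > 0" and c: "\<And>k. c k \<ge> 0" "summable c"
  shows "integrable renewal_measure (\<lambda>s. grid_sum w c (x - s))" (is ?int)
    and "(\<integral>s. grid_sum w c (x - s) \<partial>renewal_measure) = (\<Sum>k. c k * smoothed_density w (x - real k * w))" (is ?eq)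
proof -
  let ?f = "\<lambda>k s. c k * tent w ((x - real k * w) - s)"
  obtain B where B: "\<And>x. smoothed_density w x \<le> B" using smoothed_density_bounded[OF w] by blast
  have int: "integrable renewal_measure (?f k)" for k
    by (intro integrable_mult_right integrable_tent w)
  have eq: "(\<integral>s. ?f k s \<partial>renewal_measure) = c k * smoothed_density w (x - real k * w)" for k
    by (simp add: smoothed_density_def)
  have AE: "AE s in renewal_measure. summable (\<lambda>k. norm (?f k s))"
  proof (rule AE_I2)
    fix s
    show "summable (\<lambda>k. norm (?f k s))"
      by (rule summable_comparison_test'[OF c(2), of 0])
         (use c(1) tent_nonneg tent_le_1[OF w] in \<open>auto simp: abs_mult mult_left_le\<close>)
  qed
  have norm_eq: "(\<integral>s. norm (?f k s) \<partial>renewal_measure) = c k * smoothed_density w (x - real k * w)" for k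
    using c(1)[of k] by (simp add: abs_mult tent_nonneg eq[symmetric])
  have sum: "summable (\<lambda>k. \<integral>s. norm (?f k s) \<partial>renewal_measure)"
    unfolding norm_eq
  proof (rule summable_comparison_test'[of "\<lambda>k. c k * B" 0])
    show "summable (\<lambda>k. c k * B)" using c(2) by (rule summable_mult2)
    show "norm (c k * smoothed_density w (x - real k * w)) \<le> c k * B" for k
      using c(1)[of k] B[of "x - real k * w"] smoothed_density_nonneg[of w]
      by (auto simp: abs_mult intro!: mult_left_mono)
  qed
  have g: "grid_sum w c (x - s) = (\<Sum>k. ?f k s)" for s
    by (simp add: grid_sum_def algebra_simps)
  show ?int unfolding g by (rule integrable_suminf[OF int AE sum])
  show ?eq unfolding g integral_suminf[OF int AE sum] eq ..
qed

text \<open>Asymptotically every translate \<open>x - k * w\<close> can be replaced by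
  \<open>x\<close>, so only the total weight \<open>C\<close> of the coefficients matters. Dominated
  convergence for series justifies doing this in all terms at once.\<close>

lemma grid_sum_smoothed_density_limit:
  assumes w: "w > 0" and "w \<in> increment_null w" and c: "\<And>k. c k \<ge> 0" "c sums C"
  shows "((\<lambda>x. (\<integral>s. grid_sum w c (x - s) \<partial>renewal_measure) - smoothed_density w x * C) \<longlongrightarrow> 0) at_top"
proof -
  let ?Z = "smoothed_density w"
  have sc: "summable c" using c(2) by (rule sums_summable)
  obtain B where B: "\<And>x. ?Z x \<le> B" using smoothed_density_bounded[OF w] by blast
  have mem: "- (real k * w) \<in> increment_null w" for k
  proof (induction k)
    case (Suc k)
    have "- (real k * w) - w \<in> increment_null w"
      using Suc assms(2) by (rule increment_null_subgroup(3)[OF w])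
    moreover have "- (real k * w) - w = - (real (Suc k) * w)" by (simp add: algebra_simps)
    ultimately show ?case by simp
  qed (use increment_null_subgroup(2)[OF w] in simp)
  have absZ: "\<bar>?Z a - ?Z b\<bar> \<le> 2 * B" for a b
    using B[of a] B[of b] smoothed_density_nonneg[of w a] smoothed_density_nonneg[of w b] by linarith
  have lim: "((\<lambda>x. c k * (?Z (x - real k * w) - ?Z x)) \<longlongrightarrow> 0) at_top" for k
    using mem[of k] by (intro tendsto_mult_right_zero) (simp add: increment_null_def)
  have "((\<lambda>x. \<Sum>k. c k * (?Z (x - real k * w) - ?Z x)) \<longlongrightarrow> (\<Sum>k. 0)) at_top"
  proof (rule conjunct2[OF conjunct2[OF tannerys_theorem[OF lim]]])
    show "summable (\<lambda>k. c k * (2 * B))" using sc by (rule summable_mult2)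
    show "\<forall>\<^sub>F (k, x) in at_top \<times>\<^sub>F at_top. norm (c k * (?Z (x - real k * w) - ?Z x)) \<le> c k * (2 * B)"
      using c(1) absZ by (intro always_eventually) (auto simp: abs_mult intro!: mult_left_mono)
  qed auto
  moreover have "(\<Sum>k. c k * (?Z (x - real k * w) - ?Z x))
      = (\<integral>s. grid_sum w c (x - s) \<partial>renewal_measure) - ?Z x * C" for x
  proof -
    have 1: "summable (\<lambda>k. c k * ?Z (x - real k * w))"
    proof (rule summable_comparison_test'[of "\<lambda>k. c k * B" 0])
      show "summable (\<lambda>k. c k * B)" using sc by (rule summable_mult2)
      show "norm (c k * ?Z (x - real k * w)) \<le> c k * B" for k
        using c(1)[of k] B[of "x - real k * w"] smoothed_density_nonneg[of w]
        by (auto simp: abs_mult intro!: mult_left_mono)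
    qed
    have "(\<lambda>k. c k * ?Z (x - real k * w) - c k * ?Z x) sums
        ((\<Sum>k. c k * ?Z (x - real k * w)) - C * ?Z x)"
      by (intro sums_diff summable_sums 1 sums_mult2 c)
    thus ?thesis
      by (simp add: sums_iff grid_sum_renewal_integral[OF w c(1) sc] algebra_simps)
  qed
  ultimately show ?thesis by simp
qed

lemma tail_renewal_integral:
  shows "integrable renewal_measure (\<lambda>s. tail (x - s))"
    and "x \<ge> 0 \<Longrightarrow> (\<integral>s. tail (x - s) \<partial>renewal_measure) = 1"
proof -
  show "integrable renewal_measure (\<lambda>s. tail (x - s))"
  proof (rule integrable_supported[of _ 1 x])
    show "tail (x - s) = 0" if "s > x" for s using that by (simp add: tail_def)
  qed (auto simp: tail_nonneg tail_le_1)
  show "(\<integral>s. tail (x - s) \<partial>renewal_measure) = 1" if "x \<ge> 0"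
    by (subst integral_eq_nn_integral) (auto simp: tail_nonneg nn_integral_tail_renewal_measure that)
qed

text \<open>Reflection turns \<open>{0..<u}\<close> into a window open on the left and closed on the
  right, the form in which increments of the renewal function appear.\<close>

lemma window_renewal_integral:
  shows "integrable renewal_measure (\<lambda>s. indicator {0..<u} (x - s) :: real)"
    and "(\<integral>s. indicator {0..<u} (x - s) \<partial>renewal_measure) = measure renewal_measure {x - u<..x}"
proof -
  have *: "(indicator {0..<u} (x - s) :: real) = indicator {x - u<..x} s" for s
    by (auto simp: indicator_def)
  show "integrable renewal_measure (\<lambda>s. indicator {0..<u} (x - s) :: real)"
    unfolding * by (intro integrable_real_indicator emeasure_renewal_measure_bounded_finite[of _ x]) auto
  show "(\<integral>s. indicator {0..<u} (x - s) \<partial>renewal_measure) = measure renewal_measure {x - u<..x}"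
    unfolding * by simp
qed

text \<open>For \<open>y > 0\<close> the ceiling of \<open>y / w\<close> counts the
  \<open>k \<ge> 0\<close> with \<open>k * w < y\<close>. Taking expectations term by term gives the
  sum of the tails.\<close>

lemma expected_ceiling_sums:
  assumes int: "integrable interarrival (\<lambda>y. y)" and w: "w > 0"
  shows "integrable interarrival (\<lambda>y. real_of_int \<lceil>y / w\<rceil>)"
    and "(\<lambda>k. tail (real k * w)) sums (\<integral>y. of_int \<lceil>y / w\<rceil> \<partial>interarrival)"
proof -
  show int': "integrable interarrival (\<lambda>y. real_of_int \<lceil>y / w\<rceil>)"
  proof (rule Bochner_Integration.integrable_bound[of _ "\<lambda>y. y / w + 1"])
    show "integrable interarrival (\<lambda>y. y / w + 1)" using int by auto
    show "AE y in interarrival. norm (real_of_int \<lceil>y / w\<rceil>) \<le> norm (y / w + 1)"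
      using AE_interarrival_pos
    proof eventually_elim
      case (elim y)
      hence "y / w > 0" using w by simp
      thus ?case by (simp add: abs_if)
    qed
  qed measurable
  have sum_ind: "(\<Sum>k. indicator {real k * w<..} y :: ennreal) = ennreal (of_int \<lceil>y / w\<rceil>)" if "y > 0" for y
  proof -
    have yw: "y / w > 0" using w that by simp
    have iff: "real k * w < y \<longleftrightarrow> k < nat \<lceil>y / w\<rceil>" for k
    proof -
      have "real k * w < y \<longleftrightarrow> real k < y / w" using w by (simp add: field_simps)
      also have "\<dots> \<longleftrightarrow> int k < \<lceil>y / w\<rceil>" by (simp add: less_ceiling_iff)
      finally show ?thesis by linarith
    qed
    have "(\<Sum>k. indicator {real k * w<..} y :: ennreal) = (\<Sum>k\<in>{..<nat \<lceil>y / w\<rceil>}. indicator {real k * w<..} y)"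
      by (rule suminf_finite) (auto simp: iff)
    also have "\<dots> = (\<Sum>k\<in>{..<nat \<lceil>y / w\<rceil>}. 1)" by (intro sum.cong) (auto simp: iff)
    also have "\<dots> = ennreal (of_int \<lceil>y / w\<rceil>)" using yw by (simp add: ennreal_of_nat_eq_real_of_nat)
    finally show ?thesis .
  qed
  have "(\<Sum>k. ennreal (tail (real k * w))) = (\<Sum>k. \<integral>\<^sup>+y. indicator {real k * w<..} y \<partial>interarrival)"
    using w by (simp add: tail_def interarrival.emeasure_eq_measure)
  also have "\<dots> = (\<integral>\<^sup>+y. (\<Sum>k. indicator {real k * w<..} y) \<partial>interarrival)"
    by (rule nn_integral_suminf[symmetric]) auto
  also have "\<dots> = (\<integral>\<^sup>+y. ennreal (of_int \<lceil>y / w\<rceil>) \<partial>interarrival)"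
    using AE_interarrival_pos by (intro nn_integral_cong_AE) (auto elim!: eventually_mono simp: sum_ind)
  also have "\<dots> = ennreal (\<integral>y. of_int \<lceil>y / w\<rceil> \<partial>interarrival)"
  proof (rule nn_integral_eq_integral[OF int'])
    show "AE y in interarrival. 0 \<le> real_of_int \<lceil>y / w\<rceil>"
      using AE_interarrival_pos
    proof eventually_elim
      case (elim y)
      hence "y / w > 0" using w by simp
      thus ?case by linarith
    qed
  qed
  finally have "(\<lambda>k. ennreal (tail (real k * w))) sums ennreal (\<integral>y. of_int \<lceil>y / w\<rceil> \<partial>interarrival)"
    by (simp add: sums_iff summableI)
  moreover have "(\<integral>y. of_int \<lceil>y / w\<rceil> \<partial>interarrival) \<ge> (0::real)"
    using AE_interarrival_pos
  proof (intro integral_nonneg_AE, eventually_elim)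
    case (elim y)
    hence "y / w > 0" using w by simp
    thus ?case by linarith
  qed
  ultimately show "(\<lambda>k. tail (real k * w)) sums (\<integral>y. of_int \<lceil>y / w\<rceil> \<partial>interarrival)"
    by (simp add: tail_nonneg)
qed

text \<open>Grid sums of total weight at least \<open>t / w - 2\<close> and at most
  \<open>t / w + 2\<close> enclose the tail, whose integral is 1; this bounds \<open>Z\<close> on
  both sides. Grid sums of weight \<open>N - 1\<close> and \<open>N + 1\<close> enclose the
  indicator of \<open>[0, u)\<close>, which carries these bounds over to the window. Here
  \<open>t / w\<close> equals \<open>N * t / u\<close>.\<close>

lemma window_measure_sandwich:
  assumes int: "integrable interarrival (\<lambda>y. y)" and t: "t = (\<integral>y. y \<partial>interarrival)"
    and "u > 0" and w: "w = u / real N" "N > 0" "w \<in> increment_null w"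
    and N: "real N * t / u > 2"
  shows "\<exists>f g. (f \<longlongrightarrow> (real N + 1) / (real N * t / u - 2)) at_top \<and>
     (g \<longlongrightarrow> (real N - 1) / (real N * t / u + 2)) at_top \<and>
     (\<forall>\<^sub>F x in at_top. g x \<le> measure renewal_measure {x - u<..x} \<and>
        measure renewal_measure {x - u<..x} \<le> f x)"
proof -
  have w0: "w > 0" using w \<open>u > 0\<close> by simp
  have uN: "u = real N * w" using w by simp
  let ?Z = "smoothed_density w"
  define tl where "tl k = tail (real k * w)" for k :: nat
  define C where "C = (\<integral>y. of_int \<lceil>y / w\<rceil> \<partial>interarrival :: real)"
  have tlC: "tl sums C" unfolding tl_def C_def by (rule expected_ceiling_sums(2)[OF int w0])
  have tN: "real N * t / u = t / w" using w uN by simp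
  have C_lower: "t / w \<le> C"
  proof -
    have "t / w = (\<integral>y. y / w \<partial>interarrival)" by (simp add: t)
    also have "\<dots> \<le> C" unfolding C_def
      by (intro integral_mono expected_ceiling_sums(1)[OF int w0] integrable_divide_zero impI int) simp
    finally show ?thesis .
  qed
  have C_upper: "C \<le> t / w + 1"
  proof -
    have "C \<le> (\<integral>y. y / w + 1 \<partial>interarrival)" unfolding C_def
    proof (intro integral_mono expected_ceiling_sums(1)[OF int w0])
      show "integrable interarrival (\<lambda>y. y / w + 1)" using int by auto
      show "real_of_int \<lceil>y / w\<rceil> \<le> y / w + 1" for y by linarith
    qed
    also have "\<dots> = t / w + 1" using int
      by (simp add: t interarrival.prob_space[unfolded interarrival.space_eq_univ])
    finally show ?thesis .
  qed
  have tl01: "tl k \<ge> 0" "tl k \<le> 1" for k by (simp_all add: tl_def tail_nonneg tail_le_1)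
  have convex: "p * (1 - \<theta>) + q * \<theta> \<le> r" if "p \<le> r" "q \<le> r" "0 \<le> \<theta>" "\<theta> < 1" for p q r \<theta> :: real
  proof -
    have "p * (1 - \<theta>) + q * \<theta> \<le> r * (1 - \<theta>) + r * \<theta>" using that by (intro add_mono mult_right_mono) auto
    thus ?thesis by (simp add: algebra_simps)
  qed
  have convex': "r \<le> p * (1 - \<theta>) + q * \<theta>" if "r \<le> p" "r \<le> q" "0 \<le> \<theta>" "\<theta> < 1" for p q r \<theta> :: real
  proof -
    have "r * (1 - \<theta>) + r * \<theta> \<le> p * (1 - \<theta>) + q * \<theta>" using that by (intro add_mono mult_right_mono) auto
    thus ?thesis by (simp add: algebra_simps)
  qed

  \<comment> \<open>Coefficients shifted by one grid step, so that monotonicity of the tail gives bounds also between grid points.\<close>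
  define lo where "lo k = (if k = 0 then 0 else tl (Suc k))" for k
  define hi where "hi k = (case k of 0 \<Rightarrow> 1 | Suc i \<Rightarrow> tl i)" for k
  have lo_sums: "lo sums (C - tl 0 - tl 1)"
  proof -
    have "(\<lambda>k. tl (Suc (Suc k))) sums (C - tl 0 - tl (Suc 0))"
      using tlC sums_Suc_iff[of tl "C - tl 0"] sums_Suc_iff[of "\<lambda>k. tl (Suc k)" "C - tl 0 - tl (Suc 0)"] by simp
    hence "(\<lambda>k. lo (Suc k)) sums (C - tl 0 - tl (Suc 0))" by (simp add: lo_def)
    from sums_Suc[OF this] show ?thesis by (simp add: lo_def[of 0])
  qed
  have hi_sums: "hi sums (C + 1)"
  proof -
    have "(\<lambda>k. hi (Suc k)) sums C" using tlC by (simp add: hi_def)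
    from sums_Suc[OF this] show ?thesis by (simp add: hi_def[of 0])
  qed
  have lo_nonneg: "lo k \<ge> 0" and hi_nonneg: "hi k \<ge> 0" for k
    by (auto simp: lo_def hi_def tl01 split: nat.splits)
  \<comment> \<open>For \<open>y < 0\<close> the tail is 0, and so is the grid sum thanks to
    \<open>lo 0 = 0\<close>, which removes the descending piece left of the origin.\<close>
  have lo_le: "grid_sum w lo y \<le> tail y" for y
  proof (cases "y \<ge> 0")
    case False
    thus ?thesis using w0 by (simp add: grid_sum_nonpos lo_def tail_nonneg)
  next
    case True
    obtain j \<theta> where y: "y = (real j + \<theta>) * w" "0 \<le> \<theta>" "\<theta> < 1"
      using nonneg_grid_decompose[OF w0 True] .
    have le: "tl k \<le> tail y" if "k \<ge> Suc j" for k
    proof -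
      have "real (Suc j) \<le> real k" using that by linarith
      hence "y \<le> real k * w" unfolding y using w0 y(3) by (intro mult_right_mono) auto
      thus ?thesis using True by (simp add: tl_def tail_antimono)
    qed
    have "lo j \<le> tail y" "lo (Suc j) \<le> tail y" using le by (auto simp: lo_def tail_nonneg)
    hence "lo j * (1 - \<theta>) + lo (Suc j) * \<theta> \<le> tail y" using y by (intro convex)
    thus ?thesis using y w0 by (simp add: grid_sum_nonneg)
  qed
  have hi_ge: "tail y \<le> grid_sum w hi y" for y
  proof (cases "y \<ge> 0")
    case False
    thus ?thesis using w0 by (simp add: grid_sum_nonpos hi_def tent_nonneg tail_def)
  next
    case True
    obtain j \<theta> where y: "y = (real j + \<theta>) * w" "0 \<le> \<theta>" "\<theta> < 1"
      using nonneg_grid_decompose[OF w0 True] .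
    have ge: "tail y \<le> tl k" if "k \<le> j" for k
    proof -
      have "real k * w \<le> y" unfolding y using that w0 y(2) by (intro mult_right_mono) auto
      thus ?thesis using w0 by (simp add: tl_def tail_antimono)
    qed
    have "tail y \<le> hi j" "tail y \<le> hi (Suc j)" using ge by (auto simp: hi_def tail_le_1 split: nat.splits)
    hence "tail y \<le> hi j * (1 - \<theta>) + hi (Suc j) * \<theta>" using y by (intro convex')
    thus ?thesis using y w0 by (simp add: grid_sum_nonneg)
  qed

  \<comment> \<open>The lower interpolant vanishes at both ends 0 and \<open>N * w = u\<close> of
    the interval; the upper one equals 1 on all of it, both ends included.\<close>
  define lo' where "lo' = (indicator {1..<N} :: nat \<Rightarrow> real)"
  define hi' where "hi' = (indicator {..N} :: nat \<Rightarrow> real)"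
  have lo'_sums: "lo' sums (real N - 1)"
  proof -
    have "lo' sums (\<Sum>k\<in>{1..<N}. lo' k)" by (rule sums_finite) (auto simp: lo'_def)
    also have "(\<Sum>k\<in>{1..<N}. lo' k) = real N - 1" using \<open>N > 0\<close> by (simp add: lo'_def of_nat_diff)
    finally show ?thesis .
  qed
  have hi'_sums: "hi' sums (real N + 1)"
  proof -
    have "hi' sums (\<Sum>k\<in>{..N}. hi' k)" by (rule sums_finite) (auto simp: hi'_def)
    also have "(\<Sum>k\<in>{..N}. hi' k) = real N + 1" by (simp add: hi'_def)
    finally show ?thesis .
  qed
  have lo'_le: "grid_sum w lo' y \<le> indicator {0..<u} y" for y
  proof (cases "y \<ge> 0")
    case False
    thus ?thesis using w0 by (simp add: grid_sum_nonpos lo'_def)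
  next
    case True
    obtain j \<theta> where y: "y = (real j + \<theta>) * w" "0 \<le> \<theta>" "\<theta> < 1"
      using nonneg_grid_decompose[OF w0 True] .
    have "lo' j * (1 - \<theta>) + lo' (Suc j) * \<theta> \<le> indicator {0..<u} y"
    proof (cases "j < N")
      case True
      hence "real (Suc j) \<le> real N" by linarith
      hence "y < u" unfolding y uN using w0 y(3) by (intro mult_strict_right_mono) auto
      hence "indicator {0..<u} y = (1::real)" using \<open>y \<ge> 0\<close> by simp
      moreover have "lo' j * (1 - \<theta>) + lo' (Suc j) * \<theta> \<le> 1" 
        using y by (intro convex) (auto simp: lo'_def indicator_def)
      ultimately show ?thesis by simp
    qed (simp add: lo'_def)
    thus ?thesis using y w0 by (simp add: grid_sum_nonneg)
  qed
  have hi'_ge: "indicator {0..<u} y \<le> grid_sum w hi' y" for y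
  proof (cases "y \<ge> 0")
    case False
    thus ?thesis using w0 by (simp add: grid_sum_nonpos hi'_def tent_nonneg)
  next
    case True
    obtain j \<theta> where y: "y = (real j + \<theta>) * w" "0 \<le> \<theta>" "\<theta> < 1"
      using nonneg_grid_decompose[OF w0 True] .
    have "indicator {0..<u} y \<le> hi' j * (1 - \<theta>) + hi' (Suc j) * \<theta>"
    proof (cases "j < N")
      case True
      hence "hi' j = 1" "hi' (Suc j) = 1" by (auto simp: hi'_def)
      thus ?thesis by (simp add: indicator_def)
    next
      case False
      hence "real N \<le> real j + \<theta>" using y(2) by linarith
      hence "u \<le> y" unfolding y uN using w0 by (intro mult_right_mono) auto
      moreover have "hi' k \<ge> 0" for k by (simp add: hi'_def)
      ultimately show ?thesis using y by auto
    qed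
    thus ?thesis using y w0 by (simp add: grid_sum_nonneg)
  qed

  \<comment> \<open>The error made by replacing every translate of \<open>Z\<close> by
    \<open>Z x\<close>; it tends to 0.\<close>
  define err where "err c S x = (\<integral>s. grid_sum w c (x - s) \<partial>renewal_measure) - ?Z x * S" for c S x
  have err0: "(err c S \<longlongrightarrow> 0) at_top" if "\<And>k. c k \<ge> 0" "c sums S" for c S
    unfolding err_def using grid_sum_smoothed_density_limit[OF w0 w(3) that] .
  have below: "?Z x * S + err c S x \<le> (\<integral>s. \<phi> (x - s) \<partial>renewal_measure)"
    if "\<And>k. c k \<ge> 0" "c sums S" "\<And>y. grid_sum w c y \<le> \<phi> y" "integrable renewal_measure (\<lambda>s. \<phi> (x - s))"
    for c S x \<phi>
  proof -
    have "(\<integral>s. grid_sum w c (x - s) \<partial>renewal_measure) \<le> (\<integral>s. \<phi> (x - s) \<partial>renewal_measure)"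
      using that by (intro integral_mono grid_sum_renewal_integral w0 sums_summable)
    thus ?thesis by (simp add: err_def)
  qed
  have above: "(\<integral>s. \<phi> (x - s) \<partial>renewal_measure) \<le> ?Z x * S + err c S x"
    if "\<And>k. c k \<ge> 0" "c sums S" "\<And>y. \<phi> y \<le> grid_sum w c y" "integrable renewal_measure (\<lambda>s. \<phi> (x - s))"
    for c S x \<phi>
  proof -
    have "(\<integral>s. \<phi> (x - s) \<partial>renewal_measure) \<le> (\<integral>s. grid_sum w c (x - s) \<partial>renewal_measure)"
      using that by (intro integral_mono grid_sum_renewal_integral w0 sums_summable)
    thus ?thesis by (simp add: err_def)
  qed
  let ?a = "real N * t / u - 2" and ?b = "real N * t / u + 2"
  have a: "?a > 0" and b: "?b > 0" using N by auto
  \<comment> \<open>The quotients by \<open>?a\<close> and \<open>?b\<close> are the upper and lower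
    bounds for \<open>Z x\<close> obtained from the tail; inserting them into the window estimates
    eliminates \<open>Z\<close>.\<close>
  define f where "f x = (real N + 1) * ((1 - err lo (C - tl 0 - tl 1) x) / ?a) + err hi' (real N + 1) x" for x
  define g where "g x = (real N - 1) * ((1 - err hi (C + 1) x) / ?b) + err lo' (real N - 1) x" for x
  have nn: "lo' k \<ge> 0" "hi' k \<ge> 0" for k by (auto simp: lo'_def hi'_def)
  have flim: "(f \<longlongrightarrow> (real N + 1) * ((1 - 0) / ?a) + 0) at_top"
    unfolding f_def using a
    by (intro tendsto_intros err0 lo_nonneg lo_sums nn hi'_sums) auto
  have glim: "(g \<longlongrightarrow> (real N - 1) * ((1 - 0) / ?b) + 0) at_top"
    unfolding g_def using b
    by (intro tendsto_intros err0 hi_nonneg hi_sums nn lo'_sums) auto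
  have "\<forall>\<^sub>F x in at_top. g x \<le> measure renewal_measure {x - u<..x} \<and>
      measure renewal_measure {x - u<..x} \<le> f x"
    using eventually_ge_at_top[of 0]
  proof eventually_elim
    case (elim x)
    have Z0: "?Z x \<ge> 0" by (rule smoothed_density_nonneg)
    have 1: "?Z x * (C - tl 0 - tl 1) + err lo (C - tl 0 - tl 1) x \<le> 1"
      using below[of lo "C - tl 0 - tl 1" tail x, OF lo_nonneg lo_sums lo_le tail_renewal_integral(1)] tail_renewal_integral(2)[OF elim] by simp
    have 2: "1 \<le> ?Z x * (C + 1) + err hi (C + 1) x"
      using above[of hi "C + 1" tail x, OF hi_nonneg hi_sums hi_ge tail_renewal_integral(1)] tail_renewal_integral(2)[OF elim] by simp
    have 3: "?Z x * (real N - 1) + err lo' (real N - 1) x \<le> measure renewal_measure {x - u<..x}"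
      using below[of lo' "real N - 1" "indicator {0..<u}" x, OF nn(1) lo'_sums lo'_le window_renewal_integral(1)]
      by (simp add: window_renewal_integral(2))
    have 4: "measure renewal_measure {x - u<..x} \<le> ?Z x * (real N + 1) + err hi' (real N + 1) x"
      using above[of hi' "real N + 1" "indicator {0..<u}" x, OF nn(2) hi'_sums hi'_ge window_renewal_integral(1)]
      by (simp add: window_renewal_integral(2))
    have "?Z x * ?a \<le> ?Z x * (C - tl 0 - tl 1)"
      using C_lower tl01[of 0] tl01[of 1] Z0 unfolding tN by (intro mult_left_mono) auto
    with 1 have "?Z x * ?a \<le> 1 - err lo (C - tl 0 - tl 1) x" by linarith
    hence Zle: "?Z x \<le> (1 - err lo (C - tl 0 - tl 1) x) / ?a" using a by (simp only: pos_le_divide_eq)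
    have "?Z x * (C + 1) \<le> ?Z x * ?b"
      using C_upper Z0 unfolding tN by (intro mult_left_mono) auto
    with 2 have "1 - err hi (C + 1) x \<le> ?Z x * ?b" by linarith
    hence Zge: "(1 - err hi (C + 1) x) / ?b \<le> ?Z x" using b by (simp only: pos_divide_le_eq)
    have "?Z x * (real N + 1) \<le> (1 - err lo (C - tl 0 - tl 1) x) / ?a * (real N + 1)"
      using Zle by (intro mult_right_mono) auto
    moreover have "(1 - err hi (C + 1) x) / ?b * (real N - 1) \<le> ?Z x * (real N - 1)"
      using Zge \<open>N > 0\<close> by (intro mult_right_mono) auto
    ultimately show ?case using 3 4 unfolding f_def g_def by (simp only: mult.commute) linarith
  qed
  with flim glim show ?thesis by auto
qed

text \<open>Every \<open>w > 0\<close> is admissible here, in particular \<open>u / N\<close> for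
  all positive \<open>N\<close>. Both sandwich limits tend to \<open>u / t\<close> as
  \<open>N\<close> grows, so for a given tolerance one large fixed \<open>N\<close>
  suffices.\<close>

lemma window_measure_limit_nonarithmetic:
  assumes int: "integrable interarrival (\<lambda>y. y)" and t: "t = (\<integral>y. y \<partial>interarrival)" "t > 0"
    and u: "u > 0" and na: "\<not> arithmetic M T"
  shows "((\<lambda>x. measure renewal_measure {x - u<..x}) \<longlongrightarrow> u / t) at_top"
proof -
  have lim1: "(\<lambda>N. (real N + 1) / (real N * t / u - 2)) \<longlonglongrightarrow> u / t"
    and lim2: "(\<lambda>N. (real N - 1) / (real N * t / u + 2)) \<longlonglongrightarrow> u / t"
    using u t(2) by (real_asymp simp: field_simps)+
  have ev: "\<forall>\<^sub>F N in sequentially. N > 0 \<and> real N * t / u > 2"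
  proof (rule eventually_conj)
    show "\<forall>\<^sub>F N in sequentially. real N * t / u > 2" using u t(2) by real_asymp
  qed (rule eventually_gt_at_top)
  note sandwich = window_measure_sandwich[OF int t(1) u refl]
  have mem: "w \<in> increment_null w" if "w > 0" for w
    using increment_null_nonarithmetic[OF that na] by simp
  show ?thesis
  proof (rule order_tendstoI)
    fix a assume "u / t < a"
    from eventually_happens[OF eventually_conj[OF ev order_tendstoD(2)[OF lim1 this]]]
    obtain N where N: "N > 0" "real N * t / u > 2" "(real N + 1) / (real N * t / u - 2) < a" by auto
    from sandwich[OF N(1) mem N(2)] u N(1) obtain f
      where f: "(f \<longlongrightarrow> (real N + 1) / (real N * t / u - 2)) at_top"
        "\<forall>\<^sub>F x in at_top. measure renewal_measure {x - u<..x} \<le> f x"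
      by (auto simp: eventually_conj_iff)
    from f(2) order_tendstoD(2)[OF f(1) N(3)]
    show "\<forall>\<^sub>F x in at_top. measure renewal_measure {x - u<..x} < a" by eventually_elim auto
  next
    fix a assume "a < u / t"
    from eventually_happens[OF eventually_conj[OF ev order_tendstoD(1)[OF lim2 this]]]
    obtain N where N: "N > 0" "real N * t / u > 2" "a < (real N - 1) / (real N * t / u + 2)" by auto
    from sandwich[OF N(1) mem N(2)] u N(1) obtain g
      where g: "(g \<longlongrightarrow> (real N - 1) / (real N * t / u + 2)) at_top"
        "\<forall>\<^sub>F x in at_top. g x \<le> measure renewal_measure {x - u<..x}"
      by (auto simp: eventually_conj_iff)
    from g(2) order_tendstoD(1)[OF g(1) N(3)]
    show "\<forall>\<^sub>F x in at_top. a < measure renewal_measure {x - u<..x}" by eventually_elim auto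
  qed
qed

text \<open>The grid width is the span itself, so grid sums agree with the tail and the indicator at
  every lattice point. The limit is found along multiples of \<open>d\<close> and then carried over
  to real \<open>m\<close>.\<close>

lemma window_measure_limit_arithmetic:
  assumes int: "integrable interarrival (\<lambda>y. y)" and t: "t = (\<integral>y. y \<partial>interarrival)" "t > 0"
    and span: "has_span M T d"
  shows "((\<lambda>m. measure renewal_measure {m<..m + real K * d}) \<longlongrightarrow> real K * d / t) at_top"
proof -
  have d: "d > 0" "events_on_multiples M T d" using span by (auto simp: has_span_def)
  let ?Z = "smoothed_density d"
  have mem: "d \<in> increment_null d" using increment_null_span[OF d(1) span] .
  have mult: "AE s in renewal_measure. \<exists>k::int. s = of_int k * d"
    using AE_renewal_measure_multiple[OF d(2)] by eventually_elim auto
  have tail_sums: "(\<lambda>k. tail (real k * d)) sums (t / d)"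
  proof -
    \<comment> \<open>Inter-arrival times are multiples of \<open>d\<close>, so rounding up costs
      nothing and the sum of the tails is exactly \<open>t / d\<close>.\<close>
    have "(\<integral>y. of_int \<lceil>y / d\<rceil> \<partial>interarrival) = (\<integral>y. y / d \<partial>interarrival)"
    proof (rule integral_cong_AE)
      show "AE y in interarrival. of_int \<lceil>y / d\<rceil> = y / d"
        using AE_interarrival_multiple[OF d(2)] by eventually_elim (use d(1) in auto)
    qed measurable
    also have "\<dots> = t / d" by (simp add: t)
    finally show ?thesis using expected_ceiling_sums(2)[OF int d(1)] by simp
  qed
  have grid: "(\<integral>s. grid_sum d c (of_int n * d - s) \<partial>renewal_measure) = (\<integral>s. \<phi> (of_int n * d - s) \<partial>renewal_measure)"
    if "\<And>j. \<phi> (of_int j * d) = (if j \<ge> 0 then c (nat j) else 0)"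
       "\<And>k. c k \<ge> 0" "summable c" "\<phi> \<in> borel_measurable borel" for c \<phi> and n :: int
  proof (rule integral_cong_AE)
    show "(\<lambda>s. grid_sum d c (of_int n * d - s)) \<in> borel_measurable renewal_measure"
      using grid_sum_renewal_integral(1)[OF d(1) that(2,3)] by (rule borel_measurable_integrable)
    show "(\<lambda>s. \<phi> (of_int n * d - s)) \<in> borel_measurable renewal_measure"
      using that(4) by measurable
    show "AE s in renewal_measure. grid_sum d c (of_int n * d - s) = \<phi> (of_int n * d - s)"
      using mult
    proof eventually_elim
      case (elim s)
      then obtain k :: int where "s = of_int k * d" ..
      hence "of_int n * d - s = of_int (n - k) * d" by (simp add: algebra_simps)
      thus ?case using grid_sum_mult[OF d(1), of c "n - k"] that(1)[of "n - k"] by simp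
    qed
  qed
  have lim_nd: "filterlim (\<lambda>n::int. of_int n * d) at_top at_top"
    using d(1) by (intro filterlim_at_top_mult_tendsto_pos[OF tendsto_const] filterlim_of_int_at_top filterlim_ident)
  have Zlim: "((\<lambda>n::int. ?Z (of_int n * d)) \<longlongrightarrow> d / t) at_top"
  proof -
    have "((\<lambda>n::int. (\<integral>s. grid_sum d (\<lambda>k. tail (real k * d)) (of_int n * d - s) \<partial>renewal_measure)
        - ?Z (of_int n * d) * (t / d)) \<longlongrightarrow> 0) at_top"
      by (rule filterlim_compose[OF grid_sum_smoothed_density_limit[OF d(1) mem _ tail_sums] lim_nd])
         (auto simp: tail_nonneg)
    moreover have "\<forall>\<^sub>F n::int in at_top. (\<integral>s. grid_sum d (\<lambda>k. tail (real k * d)) (of_int n * d - s) \<partial>renewal_measure)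
        - ?Z (of_int n * d) * (t / d) = 1 - ?Z (of_int n * d) * (t / d)"
      using eventually_ge_at_top[of 0]
    proof eventually_elim
      case (elim n)
      have "(\<integral>s. grid_sum d (\<lambda>k. tail (real k * d)) (of_int n * d - s) \<partial>renewal_measure)
          = (\<integral>s. tail (of_int n * d - s) \<partial>renewal_measure)"
      proof (rule grid)
        show "tail (of_int j * d) = (if j \<ge> 0 then tail (real (nat j) * d) else 0)" for j
          using d(1) by (auto simp: tail_def zero_le_mult_iff)
      qed (use tail_sums in \<open>auto simp: tail_nonneg sums_iff\<close>)
      also have "\<dots> = 1" using elim d(1) by (intro tail_renewal_integral) auto
      finally show ?case by simp
    qed
    ultimately have "((\<lambda>n::int. 1 - ?Z (of_int n * d) * (t / d)) \<longlongrightarrow> 0) at_top"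
      by (rule Lim_transform_eventually)
    hence "((\<lambda>n::int. (1 - (1 - ?Z (of_int n * d) * (t / d))) * (d / t)) \<longlongrightarrow> (1 - 0) * (d / t)) at_top"
      by (intro tendsto_intros)
    thus ?thesis using d(1) t(2) by simp
  qed
  have Dlim: "((\<lambda>n::int. measure renewal_measure {of_int n * d - real K * d<..of_int n * d}) \<longlongrightarrow> real K * d / t) at_top"
  proof -
    \<comment> \<open>The grid points \<open>0, d, ..., (K - 1) * d\<close> are the lattice points
      of \<open>[0, K * d)\<close>, so the total weight is exactly \<open>K\<close>.\<close>
    let ?c = "indicator {..<K} :: nat \<Rightarrow> real"
    have c: "?c sums real K"
      using sums_finite[of "{..<K}" ?c] by simp
    have "((\<lambda>n::int. (\<integral>s. grid_sum d ?c (of_int n * d - s) \<partial>renewal_measure)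
        - ?Z (of_int n * d) * real K) \<longlongrightarrow> 0) at_top"
      by (rule filterlim_compose[OF grid_sum_smoothed_density_limit[OF d(1) mem _ c] lim_nd]) auto
    hence "((\<lambda>n::int. ((\<integral>s. grid_sum d ?c (of_int n * d - s) \<partial>renewal_measure)
        - ?Z (of_int n * d) * real K) + ?Z (of_int n * d) * real K) \<longlongrightarrow> 0 + d / t * real K) at_top"
      by (intro tendsto_intros Zlim)
    moreover have "(\<integral>s. grid_sum d ?c (of_int n * d - s) \<partial>renewal_measure)
        = measure renewal_measure {of_int n * d - real K * d<..of_int n * d}" for n :: int
    proof -
      have "(\<integral>s. grid_sum d ?c (of_int n * d - s) \<partial>renewal_measure)
          = (\<integral>s. indicator {0..<real K * d} (of_int n * d - s) \<partial>renewal_measure)"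
      proof (rule grid)
        show "indicator {0..<real K * d} (of_int j * d) = (if j \<ge> 0 then ?c (nat j) else 0)" for j
          using d(1) by (auto simp: indicator_def zero_le_mult_iff mult_less_cancel_right nat_less_iff)
      qed (use c in \<open>auto simp: sums_iff\<close>)
      thus ?thesis by (simp add: window_renewal_integral(2))
    qed
    ultimately show ?thesis by (simp add: mult.commute)
  qed
  have shift: "filterlim (\<lambda>m::real. \<lfloor>m / d\<rfloor> + int K) at_top at_top"
  proof (rule filterlim_at_top_mono[of "\<lambda>m. \<lfloor>m / d\<rfloor>"])
    show "filterlim (\<lambda>m::real. \<lfloor>m / d\<rfloor>) at_top at_top"
      by (rule filterlim_compose[OF filterlim_floor_sequentially])
         (use d(1) in \<open>real_asymp\<close>)
  qed auto
  have "((\<lambda>m. measure renewal_measure {of_int (\<lfloor>m / d\<rfloor> + int K) * d - real K * d<..of_int (\<lfloor>m / d\<rfloor> + int K) * d})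
      \<longlongrightarrow> real K * d / t) at_top"
    by (rule filterlim_compose[OF Dlim shift])
  \<comment> \<open>Rounding \<open>m\<close> down to a multiple of \<open>d\<close> shifts the
    window without changing which lattice points it contains, and the renewal measure lives on the
    lattice.\<close>
  moreover have "measure renewal_measure {of_int (\<lfloor>m / d\<rfloor> + int K) * d - real K * d<..of_int (\<lfloor>m / d\<rfloor> + int K) * d}
      = measure renewal_measure {m<..m + real K * d}" for m
  proof (rule measure_eq_AE)
    show "AE s in renewal_measure. (s \<in> {of_int (\<lfloor>m / d\<rfloor> + int K) * d - real K * d<..of_int (\<lfloor>m / d\<rfloor> + int K) * d})
        \<longleftrightarrow> (s \<in> {m<..m + real K * d})"
      using mult
    proof eventually_elim
      case (elim s)
      then obtain k :: int where s: "s = of_int k * d" ..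
      have 1: "x < of_int k * d \<longleftrightarrow> x / d < of_int k" "of_int k * d \<le> x \<longleftrightarrow> of_int k \<le> x / d" for x
        using d(1) by (simp_all add: field_simps)
      have 2: "(of_int (\<lfloor>m / d\<rfloor> + int K) * d - real K * d) / d = of_int \<lfloor>m / d\<rfloor>"
        "of_int (\<lfloor>m / d\<rfloor> + int K) * d / d = of_int (\<lfloor>m / d\<rfloor> + int K)"
        "(m + real K * d) / d = m / d + real K" using d(1) by (simp_all add: field_simps)
      have 3: "m / d < of_int k \<longleftrightarrow> \<lfloor>m / d\<rfloor> < k" by linarith
      have 4: "of_int k \<le> m / d + real K \<longleftrightarrow> k \<le> \<lfloor>m / d\<rfloor> + int K" by linarith
      have 5: "real_of_int k \<le> of_int (\<lfloor>m / d\<rfloor> + int K) \<longleftrightarrow> k \<le> \<lfloor>m / d\<rfloor> + int K" by (rule of_int_le_iff)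
      show ?case unfolding s greaterThanAtMost_iff 1 2 3 4 5 by simp
    qed
  qed auto
  ultimately show ?thesis by simp
qed

text \<open>The summand 1 is the event at time 0, which \<open>renewal_measure\<close> includes and
  \<open>event_count\<close> omits.\<close>

lemma expected_event_count:
  assumes "m \<ge> 0"
  shows "renewal_function M T m + 1 = measure renewal_measure {..m}"
proof -
  define A where "A i = {\<omega> \<in> space M. event_time T i \<omega> \<le> m}" for i
  have A [measurable]: "A i \<in> sets M" for i unfolding A_def by measurable
  define E where "E \<omega> = (\<Sum>i. indicator (A (Suc i)) \<omega> :: ennreal)" for \<omega>
  have [measurable]: "E \<in> borel_measurable M" unfolding E_def[abs_def] by measurable
  \<comment> \<open>This holds even when infinitely many events occur: \<open>card\<close> and
    \<open>enn2real\<close> then both return 0.\<close>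
  have count: "real (event_count T m \<omega>) = enn2real (E \<omega>)" if "\<omega> \<in> space M" for \<omega>
  proof -
    define S where "S = {i. \<omega> \<in> A (Suc i)}"
    have "E \<omega> = (\<integral>\<^sup>+i. indicator S i \<partial>count_space UNIV)"
      unfolding nn_integral_count_space_nat E_def S_def by (intro suminf_cong) (auto simp: indicator_def)
    hence E: "E \<omega> = emeasure (count_space UNIV) S" by simp
    have "{i. i \<ge> 1 \<and> event_time T i \<omega> \<le> m} = Suc ` S"
    proof (intro equalityI subsetI)
      fix i assume "i \<in> {i. i \<ge> 1 \<and> event_time T i \<omega> \<le> m}"
      thus "i \<in> Suc ` S" using that by (intro image_eqI[of _ _ "i - 1"]) (auto simp: S_def A_def)
    qed (auto simp: S_def A_def)
    hence "event_count T m \<omega> = card S" by (simp add: event_count_def card_image)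
    thus ?thesis unfolding E by (cases "finite S") auto
  qed
  have intE: "(\<integral>\<^sup>+\<omega>. E \<omega> \<partial>M) = (\<Sum>i. emeasure M (A (Suc i)))"
    unfolding E_def by (subst nn_integral_suminf) auto
  have total: "emeasure renewal_measure {..m} = (\<integral>\<^sup>+\<omega>. E \<omega> \<partial>M) + 1"
  proof -
    have "(\<lambda>i. emeasure M (A (Suc i))) sums (\<integral>\<^sup>+\<omega>. E \<omega> \<partial>M)"
      unfolding intE by (intro summable_sums summableI)
    from sums_unique[OF sums_Suc[OF this]]
    have "(\<integral>\<^sup>+\<omega>. E \<omega> \<partial>M) + emeasure M (A 0) = (\<Sum>i. emeasure M (A i))" .
    moreover have "A 0 = space M" using assms by (auto simp: A_def)
    ultimately show ?thesis
      by (simp add: emeasure_renewal_measure A_def emeasure_space_1)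
  qed
  have fin: "(\<integral>\<^sup>+\<omega>. E \<omega> \<partial>M) < top"
    using emeasure_renewal_measure_atMost_finite[of m] unfolding total by (auto simp: less_top)
  \<comment> \<open>The finite expectation makes the default value irrelevant up to a null
    set.\<close>
  have "AE \<omega> in M. E \<omega> \<noteq> \<infinity>" using fin by (intro nn_integral_PInf_AE) auto
  hence "(\<integral>\<^sup>+\<omega>. ennreal (enn2real (E \<omega>)) \<partial>M) = (\<integral>\<^sup>+\<omega>. E \<omega> \<partial>M)"
    by (intro nn_integral_cong_AE) (auto elim!: eventually_mono simp: less_top)
  moreover have "renewal_function M T m = (\<integral>\<omega>. enn2real (E \<omega>) \<partial>M)"
    unfolding renewal_function_def by (intro Bochner_Integration.integral_cong) (auto simp: count)
  moreover have "(\<integral>\<omega>. enn2real (E \<omega>) \<partial>M) = enn2real (\<integral>\<^sup>+\<omega>. ennreal (enn2real (E \<omega>)) \<partial>M)"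
    by (intro integral_eq_nn_integral) auto
  ultimately show ?thesis unfolding measure_def total using fin by (simp add: enn2real_plus)
qed

lemma renewal_function_increment:
  assumes "m \<ge> 0" "u \<ge> 0"
  shows "renewal_function M T (m + u) - renewal_function M T m = measure renewal_measure {m<..m + u}"
proof -
  have "measure renewal_measure ({..m + u} - {..m}) = measure renewal_measure {..m + u} - measure renewal_measure {..m}"
    using assms emeasure_renewal_measure_atMost_finite by (intro measure_Diff) (auto simp: less_top)
  moreover have "{..m + u} - {..m} = {m<..m + u}" by auto
  ultimately show ?thesis using expected_event_count[of m] expected_event_count[of "m + u"] assms by simp
qed

end

theorem theorem1:
  fixes M :: "'a measure" and T :: "nat \<Rightarrow> 'a \<Rightarrow> real" and t u :: real
  assumes "renewal_process M T"
    and "\<And>i. i \<ge> 1 \<Longrightarrow> integrable M (T i)"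
    and "\<And>i. i \<ge> 1 \<Longrightarrow> (\<integral>\<omega>. T i \<omega> \<partial>M) = t"
    and "u > 0"
  shows "(\<not> arithmetic M T \<longrightarrow>
           ((\<lambda>m::real. renewal_function M T (m + u) - renewal_function M T m)
              \<longlongrightarrow> u / t) at_top) \<and>
         (\<forall>d. arithmetic M T \<and> has_span M T d \<and> (\<exists>k::int. u = of_int k * d) \<longrightarrow>
           ((\<lambda>m::real. renewal_function M T (m + u) - renewal_function M T m)
              \<longlongrightarrow> u / t) at_top)"
proof -
  interpret renewal_process M T by fact
  have int: "integrable interarrival (\<lambda>y. y)"
    using assms(2)[of 1] measurable_T[of 1] by (simp add: interarrival_def integrable_distr_eq)
  have t: "t = (\<integral>y. y \<partial>interarrival)"
    using assms(3)[of 1] measurable_T[of 1] by (simp add: interarrival_def integral_distr)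
  \<comment> \<open>Almost sure positivity gives the strict inequality, so that \<open>u / t\<close>
    is a genuine quotient.\<close>
  have "(\<integral>y. 0 \<partial>interarrival) < (\<integral>y. y \<partial>interarrival)"
    using AE_interarrival_pos int
    by (intro interarrival.integral_less_AE_space) (auto simp: interarrival.emeasure_space_1[unfolded interarrival.space_eq_univ])
  hence t0: "t > 0" by (simp add: t)
  have incr: "\<forall>\<^sub>F m in at_top. measure renewal_measure {m<..m + u} = renewal_function M T (m + u) - renewal_function M T m"
    using eventually_ge_at_top[of 0] by eventually_elim (use assms(4) in \<open>simp add: renewal_function_increment\<close>)
  have lim: "((\<lambda>m. renewal_function M T (m + u) - renewal_function M T m) \<longlongrightarrow> u / t) at_top"
    if "((\<lambda>m. measure renewal_measure {m<..m + u}) \<longlongrightarrow> u / t) at_top"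
    using that incr by (rule Lim_transform_eventually)
  show ?thesis
  proof (intro conjI impI allI lim)
    assume "\<not> arithmetic M T"
    hence "((\<lambda>x. measure renewal_measure {x - u<..x}) \<longlongrightarrow> u / t) at_top"
      by (rule window_measure_limit_nonarithmetic[OF int t t0 assms(4)])
    \<comment> \<open>Substituting \<open>x = m + u\<close> turns the window ending at
      \<open>x\<close> into the one starting at \<open>m\<close>.\<close>
    moreover have "filterlim (\<lambda>m. m + u) at_top at_top" by real_asymp
    ultimately show "((\<lambda>m. measure renewal_measure {m<..m + u}) \<longlongrightarrow> u / t) at_top"
      using filterlim_compose by fastforce
  next
    fix d assume *: "arithmetic M T \<and> has_span M T d \<and> (\<exists>k::int. u = of_int k * d)"
    then obtain k :: int where k: "u = of_int k * d" by blast
    moreover have "d > 0" using * by (auto simp: has_span_def)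
    ultimately have "k > 0" using assms(4) by (simp add: zero_less_mult_iff)
    hence "u = real (nat k) * d" using k by simp
    thus "((\<lambda>m. measure renewal_measure {m<..m + u}) \<longlongrightarrow> u / t) at_top"
      using window_measure_limit_arithmetic[OF int t t0, of d "nat k"] * by simp
  qed
qed

end
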